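(* Let $K$ be a simply connected compact simple Lie group and $0<q<1$. Let $\mu_1,\dots,\mu_m\in\mathbf P^+$ be mutually distinct and $0<a_1,\dots,a_m<\infty$ be such that the representation $\pi_{\mu_1}\oplus\cdots\oplus\pi_{\mu_m}$ of $\mathfrak g$ is faithful, $\{\mu_1,\dots,\mu_m\}$ is invariant under $-w_0$, and $a_l=a_k$ whenever $-w_0\mu_l=\mu_k$; let $Z=Z^{\boldsymbol a}_{\boldsymbol\mu}$ be the corresponding $q$-deformed Laplacian, whose eigenvalues are $$C_Z(\lambda)=\sum_{l=1}^ma_l\sum_{j=1}^{n_{\mu_l}}\Big(\big[(\lambda+\rho,\epsilon^{\mu_l}_j)\big]_q^2-\big[(\rho,\epsilon^{\mu_l}_j)\big]_q^2\Big),\qquad\lambda\in\mathbf P^+.$$ Then these eigenvalues are lower semibounded, i.e. there is $L\in\mathbb R$ with $L\le C_Z(\lambda)$ for all $\lambda\in\mathbf P^+$. Moreover $C_Z(\lambda)\to\infty$ as $(\lambda,\lambda)\to\infty$.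
   Context: $\mathfrak g$ is the complexified Lie algebra of $K$, $(\cdot,\cdot)$ the Killing form transported to the dual of a Cartan subalgebra, $\mathbf P^+$ the dominant integral weights, $\rho$ the sum of the fundamental weights, $w_0$ the longest Weyl group element, $\pi_\mu$ the irreducible representation of $\mathfrak g$ with highest weight $\mu$, $n_\mu$ its dimension and $\epsilon^\mu_1,\dots,\epsilon^\mu_{n_\mu}$ its weights counted with multiplicity. $[x]_q=(q^x-q^{-x})/(q-q^{-1})$. The $q$-deformed Laplacian is the operator $Z^{\boldsymbol a}_{\boldsymbol\mu}\triangleright$ on $\mathfrak C^\infty(K_q)$ (the CQG Hopf $*$-algebra of the $q$-deformation of $K$) given by the central element $Z^{\boldsymbol a}_{\boldsymbol\mu}=\frac2{(q^{-1}-q)^2}\sum_la_l(z_{\mu_l}-\hat\epsilon(z_{\mu_l}))$ of $U_q(\mathfrak g)$, where $z_\mu$ is the quantum Casimir element, the central element acting on the irreducible $U_q(\mathfrak g)$-module of highest weight $\lambda$ by the scalar $\sum_jq^{-2(\lambda+\rho,\epsilon^\mu_j)}$; it acts on the Peter--Weyl block indexed by $\lambda\in\mathbf P^+$ by the scalar $C_Z(\lambda)$ displayed in the claim. *)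

theory Defs
  imports "HOL-Analysis.Analysis" "HOL-Algebra.Group" "HOL-Library.Function_Algebras"
begin

section \<open>Lie groups and their Lie algebras\<close>

text \<open>
  The \<open>C\<^sup>k\<close> and \<open>C\<^sup>\<infinity>\<close> predicates are only meant for open sets \<open>S\<close>; in the definitions below
  this is ensured by requiring charts to be open and the group operations to be continuous.
\<close>

primrec Ck_on :: "nat \<Rightarrow> 'a::euclidean_space set \<Rightarrow> ('a \<Rightarrow> 'b::euclidean_space) \<Rightarrow> bool" where
  "Ck_on 0 S f \<longleftrightarrow> continuous_on S f"
| "Ck_on (Suc k) S f \<longleftrightarrow>
     f differentiable_on S \<and> (\<forall>v. Ck_on k S (\<lambda>x. frechet_derivative f (at x) v))"

definition smooth_on :: "'a::euclidean_space set \<Rightarrow> ('a \<Rightarrow> 'b::euclidean_space) \<Rightarrow> bool" where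
  "smooth_on S f \<longleftrightarrow> (\<forall>k. Ck_on k S f)"

type_synonym ('k, 'd) chart = "'k set \<times> ('k \<Rightarrow> real ^ 'd)"

definition smooth_atlas :: "'k::t2_space set \<Rightarrow> ('k, 'd::finite) chart set \<Rightarrow> bool" where
  "smooth_atlas M A \<longleftrightarrow>
     (\<Union>(U, \<phi>)\<in>A. U) = M \<and>
     (\<forall>(U, \<phi>)\<in>A. openin (top_of_set M) U \<and> open (\<phi> ` U) \<and>
        homeomorphism U (\<phi> ` U) \<phi> (inv_into U \<phi>)) \<and>
     (\<forall>(U, \<phi>)\<in>A. \<forall>(V, \<psi>)\<in>A. smooth_on (\<phi> ` (U \<inter> V)) (\<psi> \<circ> inv_into U \<phi>))"

text \<open>
  The underlying set of the group carries the subspace topology of the Hausdorff type \<open>'k\<close>.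
  Second countability is not demanded; it is automatic for compact groups.
\<close>

definition lie_group :: "('k::t2_space) monoid \<Rightarrow> ('k, 'd::finite) chart set \<Rightarrow> bool" where
  "lie_group G A \<longleftrightarrow>
     group G \<and> smooth_atlas (carrier G) A \<and>
     continuous_on (carrier G \<times> carrier G) (\<lambda>(x, y). x \<otimes>\<^bsub>G\<^esub> y) \<and>
     continuous_on (carrier G) (\<lambda>x. inv\<^bsub>G\<^esub> x) \<and>
     (\<forall>(U, \<phi>)\<in>A. \<forall>(V, \<psi>)\<in>A. \<forall>(W, \<theta>)\<in>A.
        smooth_on {(x, y). x \<in> \<phi> ` U \<and> y \<in> \<psi> ` V \<and> inv_into U \<phi> x \<otimes>\<^bsub>G\<^esub> inv_into V \<psi> y \<in> W}
          (\<lambda>(x, y). \<theta> (inv_into U \<phi> x \<otimes>\<^bsub>G\<^esub> inv_into V \<psi> y))) \<and>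
     (\<forall>(U, \<phi>)\<in>A. \<forall>(V, \<psi>)\<in>A.
        smooth_on {x \<in> \<phi> ` U. inv\<^bsub>G\<^esub> (inv_into U \<phi> x) \<in> V} (\<lambda>x. \<psi> (inv\<^bsub>G\<^esub> (inv_into U \<phi> x))))"

text \<open>
  The Lie algebra of \<open>G\<close> is the tangent space at \<open>\<one>\<close>, identified with \<open>real ^ 'd\<close> by means of a chart
  around \<open>\<one>\<close>. A tangent vector extends to a left invariant vector field, and the bracket is the
  value at \<open>\<one>\<close> of the commutator \<open>[V, W] = DW V - DV W\<close> of the corresponding vector fields, all
  written in the chart.
\<close>

definition chart_mult ::
  "'k monoid \<Rightarrow> ('k, 'd::finite) chart \<Rightarrow> real ^ 'd \<Rightarrow> real ^ 'd \<Rightarrow> real ^ 'd" where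
  "chart_mult G c x y = snd c (inv_into (fst c) (snd c) x \<otimes>\<^bsub>G\<^esub> inv_into (fst c) (snd c) y)"

definition left_invariant_field ::
  "'k monoid \<Rightarrow> ('k, 'd::finite) chart \<Rightarrow> real ^ 'd \<Rightarrow> real ^ 'd \<Rightarrow> real ^ 'd" where
  "left_invariant_field G c X x =
     frechet_derivative (chart_mult G c x) (at (snd c \<one>\<^bsub>G\<^esub>)) X"

definition lie_bracket ::
  "'k monoid \<Rightarrow> ('k, 'd::finite) chart \<Rightarrow> real ^ 'd \<Rightarrow> real ^ 'd \<Rightarrow> real ^ 'd" where
  "lie_bracket G c X Y =
     frechet_derivative (left_invariant_field G c Y) (at (snd c \<one>\<^bsub>G\<^esub>)) X
     - frechet_derivative (left_invariant_field G c X) (at (snd c \<one>\<^bsub>G\<^esub>)) Y"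

definition simple_lie_algebra :: "(real ^ 'd \<Rightarrow> real ^ 'd \<Rightarrow> real ^ ('d::finite)) \<Rightarrow> bool" where
  "simple_lie_algebra br \<longleftrightarrow>
     (\<exists>X Y. br X Y \<noteq> 0) \<and>
     (\<forall>I. subspace I \<and> (\<forall>X. \<forall>Y\<in>I. br X Y \<in> I) \<longrightarrow> I = {0} \<or> I = UNIV)"

definition Re_vec :: "complex ^ 'd \<Rightarrow> real ^ 'd" where "Re_vec z = (\<chi> i. Re (z $ i))"
definition Im_vec :: "complex ^ 'd \<Rightarrow> real ^ 'd" where "Im_vec z = (\<chi> i. Im (z $ i))"

text \<open>The complex bilinear extension of a real bilinear bracket from \<open>real ^ 'd\<close> to \<open>complex ^ 'd\<close>.\<close>

definition complexified_bracket ::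
  "(real ^ 'd \<Rightarrow> real ^ 'd \<Rightarrow> real ^ 'd) \<Rightarrow> complex ^ 'd \<Rightarrow> complex ^ 'd \<Rightarrow> complex ^ ('d::finite)" where
  "complexified_bracket br z w =
     (\<chi> i. Complex ((br (Re_vec z) (Re_vec w) - br (Im_vec z) (Im_vec w)) $ i)
                   ((br (Re_vec z) (Im_vec w) + br (Im_vec z) (Re_vec w)) $ i))"


section \<open>Cartan subalgebras, roots and weights\<close>

text \<open>From here on \<open>br\<close> is the bracket of a complex Lie algebra with underlying space \<open>complex ^ 'd\<close>.\<close>

type_synonym 'd bracket = "complex ^ 'd \<Rightarrow> complex ^ 'd \<Rightarrow> complex ^ 'd"
type_synonym 'd weight = "complex ^ 'd \<Rightarrow> complex"

definition killing_form :: "('d::finite) bracket \<Rightarrow> complex ^ 'd \<Rightarrow> complex ^ 'd \<Rightarrow> complex" where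
  "killing_form br x y = trace (matrix (br x) ** matrix (br y))"

text \<open>Maximal abelian subalgebras all of whose elements are ad-semisimple.\<close>

definition cartan_subalgebra :: "('d::finite) bracket \<Rightarrow> (complex ^ 'd) set \<Rightarrow> bool" where
  "cartan_subalgebra br h \<longleftrightarrow>
     vec.subspace h \<and>
     (\<forall>x\<in>h. \<forall>y\<in>h. br x y = 0) \<and>
     (\<forall>x. (\<forall>y\<in>h. br x y = 0) \<longrightarrow> x \<in> h) \<and>
     (\<forall>x\<in>h. vec.span {y. \<exists>c. br x y = c *s y} = UNIV)"

text \<open>
  Linear functionals on \<open>h\<close>, extended by zero outside \<open>h\<close> so that equality of functionals is
  equality of functions.
\<close>

definition dual_space :: "(complex ^ 'd::finite) set \<Rightarrow> 'd weight set" where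
  "dual_space h = {l. (\<forall>x\<in>h. \<forall>y\<in>h. l (x + y) = l x + l y) \<and>
                      (\<forall>c. \<forall>x\<in>h. l (c *s x) = c * l x) \<and> (\<forall>x. x \<notin> h \<longrightarrow> l x = 0)}"

definition killing_dual :: "('d::finite) bracket \<Rightarrow> (complex ^ 'd) set \<Rightarrow> 'd weight \<Rightarrow> complex ^ 'd" where
  "killing_dual br h l = (THE t. t \<in> h \<and> (\<forall>x\<in>h. killing_form br t x = l x))"

definition dual_form ::
  "('d::finite) bracket \<Rightarrow> (complex ^ 'd) set \<Rightarrow> 'd weight \<Rightarrow> 'd weight \<Rightarrow> complex" where
  "dual_form br h l l' = killing_form br (killing_dual br h l) (killing_dual br h l')"

definition root_space :: "('d::finite) bracket \<Rightarrow> (complex ^ 'd) set \<Rightarrow> 'd weight \<Rightarrow> (complex ^ 'd) set" where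
  "root_space br h \<alpha> = {x. \<forall>y\<in>h. br y x = \<alpha> y *s x}"

definition roots :: "('d::finite) bracket \<Rightarrow> (complex ^ 'd) set \<Rightarrow> 'd weight set" where
  "roots br h = {\<alpha> \<in> dual_space h. \<alpha> \<noteq> 0 \<and> root_space br h \<alpha> \<noteq> {0}}"

definition nonneg_combination :: "('d::finite) weight set \<Rightarrow> 'd weight \<Rightarrow> bool" where
  "nonneg_combination \<Delta> \<beta> \<longleftrightarrow> (\<exists>c :: 'd weight \<Rightarrow> nat. \<forall>x. \<beta> x = (\<Sum>\<alpha>\<in>\<Delta>. of_nat (c \<alpha>) * \<alpha> x))"

definition simple_roots :: "('d::finite) bracket \<Rightarrow> (complex ^ 'd) set \<Rightarrow> 'd weight set \<Rightarrow> bool" where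
  "simple_roots br h \<Delta> \<longleftrightarrow>
     finite \<Delta> \<and> \<Delta> \<subseteq> roots br h \<and>
     (\<forall>c :: 'd weight \<Rightarrow> complex. (\<forall>x. (\<Sum>\<alpha>\<in>\<Delta>. c \<alpha> * \<alpha> x) = 0) \<longrightarrow> (\<forall>\<alpha>\<in>\<Delta>. c \<alpha> = 0)) \<and>
     (\<forall>\<beta>\<in>roots br h. nonneg_combination \<Delta> \<beta> \<or> nonneg_combination \<Delta> (- \<beta>))"

definition positive_roots ::
  "('d::finite) bracket \<Rightarrow> (complex ^ 'd) set \<Rightarrow> 'd weight set \<Rightarrow> 'd weight set" where
  "positive_roots br h \<Delta> = {\<beta> \<in> roots br h. nonneg_combination \<Delta> \<beta>}"

definition cartan_pairing ::
  "('d::finite) bracket \<Rightarrow> (complex ^ 'd) set \<Rightarrow> 'd weight \<Rightarrow> 'd weight \<Rightarrow> complex" where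
  "cartan_pairing br h l \<alpha> = 2 * dual_form br h l \<alpha> / dual_form br h \<alpha> \<alpha>"

definition dominant_integral_weights ::
  "('d::finite) bracket \<Rightarrow> (complex ^ 'd) set \<Rightarrow> 'd weight set \<Rightarrow> 'd weight set" where
  "dominant_integral_weights br h \<Delta> =
     {l \<in> dual_space h. \<forall>\<alpha>\<in>\<Delta>. cartan_pairing br h l \<alpha> \<in> \<nat>}"

definition fundamental_weight ::
  "('d::finite) bracket \<Rightarrow> (complex ^ 'd) set \<Rightarrow> 'd weight set \<Rightarrow> 'd weight \<Rightarrow> 'd weight" where
  "fundamental_weight br h \<Delta> \<alpha> =
     (THE l. l \<in> dual_space h \<and> (\<forall>\<beta>\<in>\<Delta>. cartan_pairing br h l \<beta> = (if \<beta> = \<alpha> then 1 else 0)))"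

definition weyl_vector ::
  "('d::finite) bracket \<Rightarrow> (complex ^ 'd) set \<Rightarrow> 'd weight set \<Rightarrow> 'd weight" where
  "weyl_vector br h \<Delta> = (\<Sum>\<alpha>\<in>\<Delta>. fundamental_weight br h \<Delta> \<alpha>)"

text \<open>
  Weyl group elements are functions on the whole type that are the identity off the dual space of
  \<open>h\<close>, so that equality of group elements is equality of functions.
\<close>

definition reflection ::
  "('d::finite) bracket \<Rightarrow> (complex ^ 'd) set \<Rightarrow> 'd weight \<Rightarrow> 'd weight \<Rightarrow> 'd weight" where
  "reflection br h \<alpha> l =
     (if l \<in> dual_space h then (\<lambda>x. l x - cartan_pairing br h l \<alpha> * \<alpha> x) else l)"

inductive_set weyl_group :: "('d::finite) bracket \<Rightarrow> (complex ^ 'd) set \<Rightarrow> ('d weight \<Rightarrow> 'd weight) set"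
  for br :: "('d::finite) bracket" and h :: "(complex ^ 'd) set" where
  "id \<in> weyl_group br h"
| "\<alpha> \<in> roots br h \<Longrightarrow> w \<in> weyl_group br h \<Longrightarrow> reflection br h \<alpha> \<circ> w \<in> weyl_group br h"

definition weyl_length ::
  "('d::finite) bracket \<Rightarrow> (complex ^ 'd) set \<Rightarrow> 'd weight set \<Rightarrow> ('d weight \<Rightarrow> 'd weight) \<Rightarrow> nat" where
  "weyl_length br h \<Delta> w =
     (LEAST n. \<exists>as. set as \<subseteq> \<Delta> \<and> length as = n \<and> w = foldr (\<lambda>\<alpha> v. reflection br h \<alpha> \<circ> v) as id)"

definition longest_element ::
  "('d::finite) bracket \<Rightarrow> (complex ^ 'd) set \<Rightarrow> 'd weight set \<Rightarrow> 'd weight \<Rightarrow> 'd weight" where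
  "longest_element br h \<Delta> = (ARG_MAX (weyl_length br h \<Delta>) w. w \<in> weyl_group br h)"


section \<open>Representations\<close>

definition lie_representation ::
  "('d::finite) bracket \<Rightarrow> (complex ^ 'd \<Rightarrow> complex ^ 'n \<Rightarrow> complex ^ ('n::finite)) \<Rightarrow> bool" where
  "lie_representation br \<pi> \<longleftrightarrow>
     (\<forall>x. Vector_Spaces.linear (*s) (*s) (\<pi> x)) \<and>
     (\<forall>x y v. \<pi> (x + y) v = \<pi> x v + \<pi> y v) \<and>
     (\<forall>c x v. \<pi> (c *s x) v = c *s \<pi> x v) \<and>
     (\<forall>x y v. \<pi> (br x y) v = \<pi> x (\<pi> y v) - \<pi> y (\<pi> x v))"

definition invariant_subspace ::
  "(complex ^ 'd \<Rightarrow> complex ^ 'n \<Rightarrow> complex ^ 'n) \<Rightarrow> (complex ^ 'n::finite) set \<Rightarrow> bool" where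
  "invariant_subspace \<pi> V \<longleftrightarrow> vec.subspace V \<and> (\<forall>x. \<forall>v\<in>V. \<pi> x v \<in> V)"

definition irreducible_subrep ::
  "(complex ^ 'd \<Rightarrow> complex ^ 'n \<Rightarrow> complex ^ 'n) \<Rightarrow> (complex ^ 'n::finite) set \<Rightarrow> bool" where
  "irreducible_subrep \<pi> V \<longleftrightarrow>
     invariant_subspace \<pi> V \<and> V \<noteq> {0} \<and>
     (\<forall>W. invariant_subspace \<pi> W \<and> W \<subseteq> V \<longrightarrow> W = {0} \<or> W = V)"

definition weight_space ::
  "(complex ^ 'd) set \<Rightarrow> (complex ^ 'd \<Rightarrow> complex ^ 'n \<Rightarrow> complex ^ 'n) \<Rightarrow>
     (complex ^ 'n) set \<Rightarrow> 'd weight \<Rightarrow> (complex ^ 'n::finite) set" where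
  "weight_space h \<pi> V \<epsilon> = {v \<in> V. \<forall>x\<in>h. \<pi> x v = \<epsilon> x *s v}"

definition weights ::
  "(complex ^ 'd::finite) set \<Rightarrow> (complex ^ 'd \<Rightarrow> complex ^ 'n \<Rightarrow> complex ^ 'n) \<Rightarrow>
     (complex ^ 'n::finite) set \<Rightarrow> 'd weight set" where
  "weights h \<pi> V = {\<epsilon> \<in> dual_space h. weight_space h \<pi> V \<epsilon> \<noteq> {0}}"

definition weight_multiplicity ::
  "(complex ^ 'd) set \<Rightarrow> (complex ^ 'd \<Rightarrow> complex ^ 'n \<Rightarrow> complex ^ 'n) \<Rightarrow>
     (complex ^ 'n::finite) set \<Rightarrow> 'd weight \<Rightarrow> nat" where
  "weight_multiplicity h \<pi> V \<epsilon> = vec.dim (weight_space h \<pi> V \<epsilon>)"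

definition irreducible_of_highest_weight ::
  "('d::finite) bracket \<Rightarrow> (complex ^ 'd) set \<Rightarrow> 'd weight set \<Rightarrow>
     (complex ^ 'd \<Rightarrow> complex ^ 'n \<Rightarrow> complex ^ 'n) \<Rightarrow> (complex ^ 'n::finite) set \<Rightarrow> 'd weight \<Rightarrow> bool" where
  "irreducible_of_highest_weight br h \<Delta> \<pi> V \<mu> \<longleftrightarrow>
     irreducible_subrep \<pi> V \<and>
     (\<exists>v\<in>weight_space h \<pi> V \<mu>. v \<noteq> 0 \<and>
        (\<forall>\<alpha>\<in>positive_roots br h \<Delta>. \<forall>x\<in>root_space br h \<alpha>. \<pi> x v = 0))"

definition direct_sum_decomposition :: "'i set \<Rightarrow> ('i \<Rightarrow> (complex ^ 'n::finite) set) \<Rightarrow> bool" where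
  "direct_sum_decomposition I V \<longleftrightarrow>
     (\<forall>i\<in>I. vec.subspace (V i)) \<and> vec.span (\<Union>i\<in>I. V i) = UNIV \<and>
     (\<forall>u. (\<forall>i\<in>I. u i \<in> V i) \<and> (\<Sum>i\<in>I. u i) = 0 \<longrightarrow> (\<forall>i\<in>I. u i = 0))"


section \<open>Eigenvalues of the q-deformed Laplacian\<close>

definition q_number :: "real \<Rightarrow> complex \<Rightarrow> complex" where
  "q_number q z = (of_real q powr z - of_real q powr (- z)) / of_real (q - inverse q)"

text \<open>
  The eigenvalue \<open>C\<^sub>Z(\<lambda>)\<close>, for irreducible representations \<open>V 1, \<dots>, V m\<close> realised inside \<open>\<pi>\<close>. The sum
  over the weights of \<open>V l\<close> counted with multiplicity is a sum over the distinct weights \<open>\<epsilon>\<close>, each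
  term being multiplied by the dimension of the weight space of \<open>\<epsilon>\<close>.
\<close>

definition laplacian_eigenvalue ::
  "real \<Rightarrow> ('d::finite) bracket \<Rightarrow> (complex ^ 'd) set \<Rightarrow> 'd weight set \<Rightarrow>
     (complex ^ 'd \<Rightarrow> complex ^ 'n \<Rightarrow> complex ^ 'n) \<Rightarrow> nat \<Rightarrow> (nat \<Rightarrow> (complex ^ 'n::finite) set) \<Rightarrow>
     (nat \<Rightarrow> real) \<Rightarrow> 'd weight \<Rightarrow> complex" where
  "laplacian_eigenvalue q br h \<Delta> \<pi> m V a l =
     (\<Sum>i=1..m. of_real (a i) *
        (\<Sum>\<epsilon>\<in>weights h \<pi> (V i). of_nat (weight_multiplicity h \<pi> (V i) \<epsilon>) *
           ((q_number q (dual_form br h (l + weyl_vector br h \<Delta>) \<epsilon>))\<^sup>2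
            - (q_number q (dual_form br h (weyl_vector br h \<Delta>) \<epsilon>))\<^sup>2)))"

end

theory Submission
  imports Defs
begin

text \<open>
  Because \<open>\<pi>\<close> is faithful, the bracket satisfies the Lie algebra axioms. On \<open>h\<close> the Killing form is
  the sum of \<open>\<beta> x * \<beta> y\<close> over an eigenbasis of the adjoint action; evaluating it where all simple roots
  equal \<open>1\<close> shows that it is not zero, and simplicity makes it nondegenerate. On the real span of the
  coroots it is positive definite, and \<open>\<lambda>\<close>, \<open>\<rho>\<close> and (by an \<open>sl\<^sub>2\<close> ladder argument) the weights of \<open>\<pi>\<close>
  are real there. Hence \<open>[(\<lambda> + \<rho>, \<epsilon>)]\<^sub>q\<^sup>2\<close> is at least a positive constant times \<open>(\<lambda> + \<rho>, \<epsilon>)\<^sup>2\<close>, which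
  bounds the eigenvalue from below, and since the weights of the faithful \<open>\<pi>\<close> separate the points of
  \<open>h\<close>, the sum of these squares dominates \<open>(\<lambda> + \<rho>, \<lambda> + \<rho>)\<close>.
\<close>

section \<open>Linear algebra\<close>

text \<open>Commutators of operators satisfy the Lie algebra axioms, so faithfulness spares deriving
  them from left invariant fields in a chart. The complexification of a simple real Lie algebra need
  not be simple, hence the ideal argument for nondegeneracy runs over real points. It needs one
  nonzero value of the Killing form; integrality of roots with respect to the simple roots supplies
  it, in place of Cartan's criterion. Reality of the pairings is the crux: on an imaginary argument
  the q-number is imaginary and its square nonpositive, so without reality a lower bound could fail.
  Integrality of the weights is never derived, which keeps the ladder argument short. The quadratic
  bound on q-numbers is far weaker than their exponential growth, but it reduces the claim to
  comparing two quadratic forms on a finite-dimensional real space. The shift by \<rho> then costs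
  only an additive constant.\<close>

definition linear_functional_on :: "('a::field ^ 'd::finite) set \<Rightarrow> ('a ^ 'd \<Rightarrow> 'a) \<Rightarrow> bool" where
  "linear_functional_on h f \<longleftrightarrow>
     (\<forall>x\<in>h. \<forall>y\<in>h. f (x + y) = f x + f y) \<and> (\<forall>c. \<forall>x\<in>h. f (c *s x) = c * f x)"

lemma linear_functional_on_subset:
  "linear_functional_on h f \<Longrightarrow> h' \<subseteq> h \<Longrightarrow> linear_functional_on h' f"
  unfolding linear_functional_on_def by blast

lemma linear_functional_on_zero:
  assumes "linear_functional_on h f" "vec.subspace h"
  shows "f 0 = 0"
proof -
  have "f (0 *s 0) = 0 * f 0"
    using assms unfolding linear_functional_on_def by (meson vec.subspace_0)
  then show ?thesis by simp
qed

lemma linear_functional_on_sum: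
  assumes f: "linear_functional_on h f" and h: "vec.subspace h" and v: "\<And>i. i \<in> I \<Longrightarrow> v i \<in> h"
  shows "f (\<Sum>i\<in>I. v i) = (\<Sum>i\<in>I. f (v i))"
  using v
proof (induction I rule: infinite_finite_induct)
  case (insert i I)
  then have "(\<Sum>i\<in>I. v i) \<in> h" by (intro vec.subspace_sum h) auto
  with insert f show ?case unfolding linear_functional_on_def by simp
qed (use linear_functional_on_zero[OF f h] in auto)

lemma linear_functional_on_minus:
  assumes f: "linear_functional_on h f" and h: "vec.subspace h" and "x \<in> h" "y \<in> h"
  shows "f (x - y) = f x - f y"
proof -
  have "f (x + (-1) *s y) = f x + (-1) * f y"
    using assms unfolding linear_functional_on_def by (metis vec.subspace_scale)
  then show ?thesis by (simp add: vec.scale_minus_left)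
qed

lemma linear_functional_on_combination:
  assumes "finite I" "\<And>i. i \<in> I \<Longrightarrow> linear_functional_on h (f i)"
  shows "linear_functional_on h (\<lambda>x. \<Sum>i\<in>I. c i * f i x)"
proof -
  have "(\<Sum>i\<in>I. c i * f i (x + y)) = (\<Sum>i\<in>I. c i * f i x) + (\<Sum>i\<in>I. c i * f i y)"
    if "x \<in> h" "y \<in> h" for x y
    using assms that unfolding linear_functional_on_def
    by (simp add: distrib_left sum.distrib cong: sum.cong)
  moreover have "(\<Sum>i\<in>I. c i * f i (k *s x)) = k * (\<Sum>i\<in>I. c i * f i x)" if "x \<in> h" for k x
    using assms that unfolding linear_functional_on_def sum_distrib_left
    by (intro sum.cong) (auto simp: mult_ac)
  ultimately show ?thesis unfolding linear_functional_on_def by blast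
qed

text \<open>On the kernel of one \<open>f i\<close> the remaining functionals suffice by induction,
  which is why \<open>h\<close> varies. The error of that combination vanishes on this kernel and is
  therefore a multiple of \<open>f i\<close>. The lemma replaces dimension counts
  throughout.\<close>

lemma functional_in_span_of_common_kernel:
  fixes h :: "('a::field ^ 'd::finite) set"
  assumes "finite I" "vec.subspace h" "\<And>i. i \<in> I \<Longrightarrow> linear_functional_on h (f i)"
    and "linear_functional_on h g" "\<And>x. x \<in> h \<Longrightarrow> (\<And>i. i \<in> I \<Longrightarrow> f i x = 0) \<Longrightarrow> g x = 0"
  shows "\<exists>c. \<forall>x\<in>h. g x = (\<Sum>i\<in>I. c i * f i x)"
  using assms
proof (induction I arbitrary: h rule: finite_induct)
  case (insert i I)
  let ?h = "{x \<in> h. f i x = 0}"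
  have fi: "linear_functional_on h (f i)" using insert.prems by simp
  have sub: "vec.subspace ?h"
    using insert.prems(1) fi linear_functional_on_zero[OF fi]
    unfolding vec.subspace_def linear_functional_on_def by auto
  have "\<exists>c. \<forall>x\<in>?h. g x = (\<Sum>i\<in>I. c i * f i x)"
    by (rule insert.IH[OF sub]) (use insert.prems in \<open>auto intro: linear_functional_on_subset\<close>)
  then obtain c where c: "\<And>x. x \<in> h \<Longrightarrow> f i x = 0 \<Longrightarrow> g x = (\<Sum>i\<in>I. c i * f i x)" by auto
  define g' where "g' = (\<lambda>x. \<Sum>i\<in>I. c i * f i x)"
  have g': "linear_functional_on h g'"
    unfolding g'_def using insert by (intro linear_functional_on_combination) auto
  obtain d where d: "\<And>x. x \<in> h \<Longrightarrow> g x = d * f i x + g' x"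
  proof (cases "\<exists>y\<in>h. f i y \<noteq> 0")
    case False
    then show ?thesis using that[of 0] c by (simp add: g'_def)
  next
    case True
    then obtain y where y: "y \<in> h" "f i y \<noteq> 0" by blast
    \<comment> \<open>Any \<open>y\<close> outside the kernel of \<open>f i\<close> fixes the
      factor, since each \<open>x\<close> differs from a multiple of \<open>y\<close> by a kernel
      element.\<close>
    define d where "d = (g y - g' y) / f i y"
    show ?thesis
    proof (rule that)
      fix x assume x: "x \<in> h"
      define k where "k = f i x / f i y"
      have k: "k *s y \<in> h" using insert.prems(1) y by (simp add: vec.subspace_scale)
      then have z: "x - k *s y \<in> h" using insert.prems(1) x by (simp add: vec.subspace_diff)
      have lin: "\<phi> (x - k *s y) = \<phi> x - k * \<phi> y" if "linear_functional_on h \<phi>" for \<phi>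
        using linear_functional_on_minus[OF that insert.prems(1) x k] that y(1)
        unfolding linear_functional_on_def by simp
      have "f i (x - k *s y) = 0" using lin[OF fi] y by (simp add: k_def)
      then have "g (x - k *s y) = g' (x - k *s y)" using c[OF z] by (simp add: g'_def)
      then have "g x - k * g y = g' x - k * g' y" using lin g' insert.prems(3) by simp
      then show "g x = d * f i x + g' x" using y by (simp add: d_def k_def field_simps)
    qed
  qed
  have "(\<Sum>j\<in>I. (c(i := d)) j * f j x) = g' x" for x
    unfolding g'_def using insert.hyps by (intro sum.cong) auto
  then have "g x = (\<Sum>j\<in>insert i I. (c(i := d)) j * f j x)" if "x \<in> h" for x
    using d[OF that] insert.hyps by simp
  then show ?case by blast
qed auto

text \<open>It suffices to find vectors dual to the functionals up to scaling. If every common zero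
  of the others were a zero of \<open>f i\<close>, then \<open>f i\<close> would be a combination of
  the others, against independence.\<close>

lemma independent_functionals_interpolate:
  fixes h :: "('a::field ^ 'd::finite) set"
  assumes I: "finite I" and h: "vec.subspace h"
    and f: "\<And>i. i \<in> I \<Longrightarrow> linear_functional_on h (f i)"
    and indep: "\<And>c i. (\<And>x. x \<in> h \<Longrightarrow> (\<Sum>i\<in>I. c i * f i x) = 0) \<Longrightarrow> i \<in> I \<Longrightarrow> c i = 0"
  shows "\<exists>x\<in>h. \<forall>i\<in>I. f i x = g i"
proof -
  have "\<exists>x\<in>h. f i x \<noteq> 0 \<and> (\<forall>j\<in>I - {i}. f j x = 0)" if i: "i \<in> I" for i
  proof (rule ccontr)
    assume *: "\<not> ?thesis"
    have "\<exists>c. \<forall>x\<in>h. f i x = (\<Sum>j\<in>I - {i}. c j * f j x)"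
      by (rule functional_in_span_of_common_kernel) (use * I h f i in auto)
    then obtain c where c: "\<And>x. x \<in> h \<Longrightarrow> f i x = (\<Sum>j\<in>I - {i}. c j * f j x)" by blast
    \<comment> \<open>The coefficient \<open>-1\<close> at \<open>i\<close> turns the expression of
      \<open>f i\<close> through the others into a vanishing combination.\<close>
    have "(\<Sum>j\<in>I. (c(i := -1)) j * f j x) = 0" if "x \<in> h" for x
    proof -
      have "(\<Sum>j\<in>I - {i}. (c(i := -1)) j * f j x) = (\<Sum>j\<in>I - {i}. c j * f j x)"
        by (intro sum.cong) auto
      then show ?thesis using c[OF that] I i by (simp add: sum.remove)
    qed
    from indep[of "c(i := -1)", OF this i] show False by simp
  qed
  then obtain x where x: "\<And>i. i \<in> I \<Longrightarrow> x i \<in> h \<and> f i (x i) \<noteq> 0 \<and> (\<forall>j\<in>I - {i}. f j (x i) = 0)"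
    by metis
  define y where "y = (\<Sum>i\<in>I. (g i / f i (x i)) *s x i)"
  have mem: "(g i / f i (x i)) *s x i \<in> h" if "i \<in> I" for i
    using x[OF that] h by (simp add: vec.subspace_scale)
  have "f j y = g j" if j: "j \<in> I" for j
  proof -
    have "f j y = (\<Sum>i\<in>I. f j ((g i / f i (x i)) *s x i))"
      unfolding y_def using linear_functional_on_sum[OF f[OF j] h mem] .
    also have "\<dots> = (\<Sum>i\<in>I. if i = j then g j else 0)"
    proof (intro sum.cong refl)
      fix i assume i: "i \<in> I"
      have "f j ((g i / f i (x i)) *s x i) = g i / f i (x i) * f j (x i)"
        using f[OF j] x[OF i] unfolding linear_functional_on_def by blast
      then show "f j ((g i / f i (x i)) *s x i) = (if i = j then g j else 0)"
        using x[OF i] j by auto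
    qed
    finally show ?thesis using I j by simp
  qed
  moreover have "y \<in> h" unfolding y_def by (intro vec.subspace_sum h mem)
  ultimately show ?thesis by blast
qed

section \<open>Eigenvectors, simultaneous diagonalization and traces\<close>

lemma eigenvectors_sum_zero:
  fixes A :: "'a::field ^ 'n::finite \<Rightarrow> 'a ^ 'n"
  assumes A: "Vector_Spaces.linear (*s) (*s) A" and "finite S"
    and "\<And>c. c \<in> S \<Longrightarrow> A (v c) = c *s v c" "(\<Sum>c\<in>S. v c) = 0" "c \<in> S"
  shows "v c = 0"
  using assms(2-)
proof (induction S arbitrary: v c rule: finite_induct)
  case (insert d S)
  interpret A: Vector_Spaces.linear "(*s)" "(*s)" A by (rule A)
  have "A (\<Sum>c\<in>insert d S. v c) = 0" using insert.prems by simp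
  then have "(\<Sum>c\<in>insert d S. c *s v c) = 0"
    unfolding A.sum using insert.prems(1) by (metis (no_types, lifting) sum.cong)
  moreover have "(\<Sum>c\<in>insert d S. d *s v c) = 0"
    using insert.prems(2) by (simp only: vec.scale_sum_right[symmetric]) simp
  \<comment> \<open>Applying \<open>A\<close> minus \<open>d\<close> kills the
    \<open>d\<close>-component and rescales each other one by a nonzero factor, so the induction
    hypothesis applies to the rescaled vectors.\<close>
  ultimately have "(\<Sum>c\<in>insert d S. (c - d) *s v c) = 0"
    by (simp only: vec.scale_left_diff_distrib sum_subtractf diff_self)
  then have z: "(\<Sum>c\<in>S. (c - d) *s v c) = 0" using insert.hyps by simp
  have S: "v c = 0" if "c \<in> S" for c
  proof -
    have "(c - d) *s v c = 0"
      by (rule insert.IH[OF _ z that])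
        (use insert.prems(1) in \<open>simp only: A.scale vector_smult_assoc mult.commute insertI2\<close>)
    then show ?thesis using that insert.hyps by auto
  qed
  then have "v d = 0" using insert.prems(2) insert.hyps by simp
  with S insert.prems(3) show ?case by auto
qed auto

lemma diagonalizable_decomposition:
  fixes A :: "'a::field ^ 'n::finite \<Rightarrow> 'a ^ 'n"
  assumes A: "Vector_Spaces.linear (*s) (*s) A" and span: "vec.span {y. \<exists>c. A y = c *s y} = UNIV"
  obtains S w where "finite S" "\<And>c. A (w c) = c *s w c" "v = (\<Sum>c\<in>S. w c)"
proof -
  interpret A: Vector_Spaces.linear "(*s)" "(*s)" A by (rule A)
  \<comment> \<open>Requiring \<open>w c = 0\<close> off \<open>S\<close> lets two decompositions be
    added over the union of their index sets.\<close>
  define D where "D = {v. \<exists>S w. finite S \<and> (\<forall>c. A (w c) = c *s w c) \<and> (\<forall>c. c \<notin> S \<longrightarrow> w c = 0) \<and>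
     v = (\<Sum>c\<in>S. w c)}"
  have "vec.subspace D"
  proof (rule vec.subspaceI)
    show "0 \<in> D" unfolding D_def by (auto intro!: exI[of _ "{}"] exI[of _ "\<lambda>_. 0"])
  next
    fix x y assume "x \<in> D" "y \<in> D"
    then obtain S w S' w' where *: "finite S" "\<forall>c. A (w c) = c *s w c" "\<forall>c. c \<notin> S \<longrightarrow> w c = 0"
      "x = (\<Sum>c\<in>S. w c)" "finite S'" "\<forall>c. A (w' c) = c *s w' c" "\<forall>c. c \<notin> S' \<longrightarrow> w' c = 0"
      "y = (\<Sum>c\<in>S'. w' c)"
      unfolding D_def by blast
    have "x = (\<Sum>c\<in>S \<union> S'. w c)" "y = (\<Sum>c\<in>S \<union> S'. w' c)"
      using * by (auto intro!: sum.mono_neutral_left)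
    then have "x + y = (\<Sum>c\<in>S \<union> S'. w c + w' c)" by (simp add: sum.distrib)
    then show "x + y \<in> D" unfolding D_def using *
      by (auto intro!: exI[of _ "S \<union> S'"] exI[of _ "\<lambda>c. w c + w' c"]
          simp: A.add vec.scale_right_distrib)
  next
    fix k x assume "x \<in> D"
    then obtain S w where *: "finite S" "\<forall>c. A (w c) = c *s w c" "\<forall>c. c \<notin> S \<longrightarrow> w c = 0"
      "x = (\<Sum>c\<in>S. w c)"
      unfolding D_def by blast
    then show "k *s x \<in> D" unfolding D_def
      by (auto intro!: exI[of _ "S"] exI[of _ "\<lambda>c. k *s w c"]
          simp: A.scale vec.scale_sum_right vector_smult_assoc mult.commute)
  qed
  moreover have "{y. \<exists>c. A y = c *s y} \<subseteq> D"
  proof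
    fix y assume "y \<in> {y. \<exists>c. A y = c *s y}"
    then obtain c where c: "A y = c *s y" by blast
    then show "y \<in> D" unfolding D_def
      by (auto intro!: exI[of _ "{c}"] exI[of _ "\<lambda>d. if d = c then y else 0"] split: if_splits)
  qed
  ultimately have "vec.span {y. \<exists>c. A y = c *s y} \<subseteq> D" by (rule vec.span_minimal[rotated])
  then have "v \<in> D" using span by auto
  then show ?thesis using that unfolding D_def by blast
qed

text \<open>A common eigenvector \<open>v\<close> for \<open>F\<close> is split into eigenvectors
  \<open>w c\<close> of the new operator \<open>A x\<close>. If \<open>A y v = d *s v\<close>, then
  by commutation the defects \<open>A y (w c) - d *s w c\<close> lie in distinct eigenspaces of
  \<open>A x\<close> and sum to zero, so each vanishes and the pieces remain eigenvectors for
  \<open>F\<close>.\<close>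

lemma simultaneously_diagonalizable:
  fixes A :: "'i \<Rightarrow> 'a::field ^ 'n::finite \<Rightarrow> 'a ^ 'n"
  assumes "finite F" and "\<And>x. x \<in> F \<Longrightarrow> Vector_Spaces.linear (*s) (*s) (A x)"
    and "\<And>x. x \<in> F \<Longrightarrow> vec.span {v. \<exists>c. A x v = c *s v} = UNIV"
    and "\<And>x y v. x \<in> F \<Longrightarrow> y \<in> F \<Longrightarrow> A x (A y v) = A y (A x v)"
  shows "vec.span {v. \<forall>x\<in>F. \<exists>c. A x v = c *s v} = UNIV"
  using assms
proof (induction F rule: finite_induct)
  case (insert x F)
  let ?E = "\<lambda>F. {v. \<forall>x\<in>F. \<exists>c. A x v = c *s v}"
  have "?E F \<subseteq> vec.span (?E (insert x F))"
  proof
    fix v assume v: "v \<in> ?E F"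
    have x: "Vector_Spaces.linear (*s) (*s) (A x)" using insert.prems by simp
    have "vec.span {v. \<exists>c. A x v = c *s v} = UNIV" using insert.prems by simp
    from diagonalizable_decomposition[OF x this]
    obtain S w where S: "finite S" and w: "\<And>c. A x (w c) = c *s w c" and vw: "v = (\<Sum>c\<in>S. w c)"
      by metis
    have "w c \<in> ?E (insert x F)" if c: "c \<in> S" for c
    proof -
      have "A y (w c) = d *s w c" if y: "y \<in> F" and d: "A y v = d *s v" for y d
      proof -
        interpret Ax: Vector_Spaces.linear "(*s)" "(*s)" "A x" by (rule x)
        interpret Ay: Vector_Spaces.linear "(*s)" "(*s)" "A y" using insert.prems y by simp
        have comm: "A x (A y u) = A y (A x u)" for u using insert.prems y by simp
        have "A y (w c) - d *s w c = 0"
        proof (rule eigenvectors_sum_zero[OF x S _ _ c])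
          show "A x (A y (w c) - d *s w c) = c *s (A y (w c) - d *s w c)" for c
            by (simp add: Ax.diff Ax.scale comm w Ay.scale vec.scale_right_diff_distrib
                vector_smult_assoc mult.commute)
          show "(\<Sum>c\<in>S. A y (w c) - d *s w c) = 0"
            using d unfolding vw by (simp add: Ay.sum sum_subtractf vec.scale_sum_right)
        qed
        then show ?thesis by simp
      qed
      then show ?thesis using v w by blast
    qed
    then show "v \<in> vec.span (?E (insert x F))"
      unfolding vw by (intro vec.span_sum vec.span_base)
  qed
  then have "vec.span (?E F) \<subseteq> vec.span (?E (insert x F))"
    by (rule vec.span_minimal) (rule vec.subspace_span)
  moreover have "vec.span (?E F) = UNIV" using insert by simp
  ultimately show ?case by auto
qed auto

text \<open>Eigenvectors for distinct eigenvalues are independent, so their number cannot exceed the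
  dimension. This is what stops the ladders of raising and lowering operators.\<close>

lemma eigenvalues_finite:
  fixes A :: "'a::field ^ 'n::finite \<Rightarrow> 'a ^ 'n"
  assumes A: "Vector_Spaces.linear (*s) (*s) A"
  shows "finite {c. \<exists>v. v \<noteq> 0 \<and> A v = c *s v}"
proof (rule ccontr)
  assume "infinite {c. \<exists>v. v \<noteq> 0 \<and> A v = c *s v}"
  then obtain S where S: "S \<subseteq> {c. \<exists>v. v \<noteq> 0 \<and> A v = c *s v}" "finite S" "card S = Suc CARD('n)"
    by (meson infinite_arbitrarily_large)
  then have "\<forall>c\<in>S. \<exists>v. v \<noteq> 0 \<and> A v = c *s v" by blast
  then obtain v where "\<forall>c\<in>S. v c \<noteq> 0 \<and> A (v c) = c *s v c"
    using bchoice[of S "\<lambda>c v. v \<noteq> 0 \<and> A v = c *s v"] by blast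
  then have v: "v c \<noteq> 0 \<and> A (v c) = c *s v c" if "c \<in> S" for c using that by blast
  have inj: "inj_on v S"
  proof (rule inj_onI)
    fix c d assume "c \<in> S" "d \<in> S" "v c = v d"
    then have "(c - d) *s v c = 0" using v by (metis vec.scale_left_diff_distrib diff_self)
    then show "c = d" using v \<open>c \<in> S\<close> by auto
  qed
  have "vec.independent (v ` S)"
  proof (rule vec.independent_if_scalars_zero)
    fix f x assume f: "(\<Sum>x\<in>v ` S. f x *s x) = 0" and "x \<in> v ` S"
    then obtain c where c: "c \<in> S" "x = v c" by blast
    interpret A: Vector_Spaces.linear "(*s)" "(*s)" A by (rule A)
    have "f (v c) *s v c = 0"
    proof (rule eigenvectors_sum_zero[OF A S(2) _ _ c(1)])
      show "A (f (v c) *s v c) = c *s (f (v c) *s v c)" if "c \<in> S" for c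
        using v[OF that] by (simp add: A.scale vector_smult_assoc mult.commute)
      show "(\<Sum>c\<in>S. f (v c) *s v c) = 0" using f inj by (simp add: sum.reindex)
    qed
    then show "f x = 0" using v c by simp
  qed (use S in simp)
  then have "card (v ` S) \<le> CARD('n)"
    using vec.independent_card_le_dim[of "v ` S" UNIV] by (metis subset_UNIV vec_dim_card)
  then show False using inj S by (simp add: card_image)
qed

text \<open>This is basis independence of the trace for a diagonalizable map, obtained by inserting
  coordinates with respect to \<open>B\<close> and swapping the two sums.\<close>

lemma trace_eigenbasis:
  fixes f :: "'a::field ^ 'n::finite \<Rightarrow> 'a ^ 'n"
  assumes f: "Vector_Spaces.linear (*s) (*s) f"
    and B: "finite B" "vec.independent B" "vec.span B = UNIV"
    and d: "\<And>b. b \<in> B \<Longrightarrow> f b = d b *s b"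
  shows "(\<Sum>i\<in>UNIV. f (axis i 1) $ i) = (\<Sum>b\<in>B. d b)"
proof -
  interpret f: Vector_Spaces.linear "(*s)" "(*s)" f by (rule f)
  define r where "r = vec.representation B"
  have rep: "v = (\<Sum>b\<in>B. r v b *s b)" for v
    unfolding r_def using vec.sum_representation_eq[OF B(2) _ B(1), of v] B(3) by simp
  have fv: "f v = (\<Sum>b\<in>B. (r v b * d b) *s b)" for v
    by (subst rep[of v]) (simp add: f.sum f.scale d vector_smult_assoc cong: sum.cong)
  have unit: "(\<Sum>i\<in>UNIV. r (axis i 1) b * b $ i) = 1" if b: "b \<in> B" for b
  proof -
    \<comment> \<open>Expanding \<open>b\<close> in the standard basis and reading off its own
      coordinate makes the inner sum equal to 1.\<close>
    have "r b b = (\<Sum>i\<in>UNIV. r (b $ i *s axis i 1) b)"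
      using vec.representation_sum[OF B(2), of UNIV "\<lambda>i. b $ i *s axis i 1"] B(3)
      by (simp add: r_def basis_expansion)
    also have "\<dots> = (\<Sum>i\<in>UNIV. r (axis i 1) b * b $ i)"
      using B(3) unfolding r_def
      by (intro sum.cong refl) (simp add: vec.representation_scale[OF B(2)] mult.commute)
    finally show ?thesis using vec.representation_basis[OF B(2) b] by (simp add: r_def)
  qed
  have "(\<Sum>i\<in>UNIV. f (axis i 1) $ i) = (\<Sum>i\<in>UNIV. \<Sum>b\<in>B. d b * (r (axis i 1) b * b $ i))"
    by (subst fv) (simp add: mult_ac)
  also have "\<dots> = (\<Sum>b\<in>B. d b * (\<Sum>i\<in>UNIV. r (axis i 1) b * b $ i))"
    by (subst sum.swap) (simp add: sum_distrib_left)
  also have "\<dots> = (\<Sum>b\<in>B. d b)" by (simp add: unit)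
  finally show ?thesis .
qed

section \<open>Weight vectors\<close>

lemma dual_space_iff:
  "l \<in> dual_space h \<longleftrightarrow> linear_functional_on h l \<and> (\<forall>x. x \<notin> h \<longrightarrow> l x = 0)"
  unfolding dual_space_def linear_functional_on_def by auto

lemma dual_space_eqI:
  "l \<in> dual_space h \<Longrightarrow> l' \<in> dual_space h \<Longrightarrow> (\<And>x. x \<in> h \<Longrightarrow> l x = l' x) \<Longrightarrow> l = l'"
  unfolding dual_space_iff by (intro ext) metis

lemma dual_space_zero: "0 \<in> dual_space h"
  by (simp add: dual_space_def)

lemma dual_space_add: "l \<in> dual_space h \<Longrightarrow> l' \<in> dual_space h \<Longrightarrow> l + l' \<in> dual_space h"
  by (auto simp: dual_space_def algebra_simps)

text \<open>For nonzero \<open>v\<close> each eigenvalue is determined by the element acting, and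
  this uniqueness makes it linear. Extension by zero off \<open>h\<close> puts it into
  \<open>dual_space h\<close>.\<close>

lemma common_eigenvector_has_weight:
  assumes add: "\<And>x y v. \<pi> (x + y) v = \<pi> x v + \<pi> y v"
    and scale: "\<And>c x v. \<pi> (c *s x) v = c *s \<pi> x v"
    and h: "vec.subspace h" and v: "\<And>x. x \<in> h \<Longrightarrow> \<exists>c. \<pi> x v = c *s v"
  shows "\<exists>\<epsilon>\<in>dual_space h. v \<in> weight_space h \<pi> UNIV \<epsilon>"
proof (cases "v = 0")
  case True
  \<comment> \<open>The zero vector lies in every weight space, so the weight 0 serves.\<close>
  then have "\<pi> x v = 0 *s v" if "x \<in> h" for x using v[OF that] by auto
  then show ?thesis by (intro bexI[OF _ dual_space_zero]) (simp add: weight_space_def)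
next
  case False
  obtain e where e: "\<And>x. x \<in> h \<Longrightarrow> \<pi> x v = e x *s v" using v by metis
  define \<epsilon> where "\<epsilon> = (\<lambda>x. if x \<in> h then e x else 0)"
  have uniq: "c = d" if "c *s v = d *s v" for c d
    using that False by (metis vec.scale_right_imp_eq)
  have "\<epsilon> \<in> dual_space h"
    unfolding dual_space_def
  proof (clarsimp, intro conjI ballI allI impI)
    fix x y assume xy: "x \<in> h" "y \<in> h"
    then have "x + y \<in> h" using h by (rule_tac vec.subspace_add)
    then have "e (x + y) *s v = (e x + e y) *s v"
      using add[of x y v] e xy by (simp add: vec.scale_left_distrib)
    then have "e (x + y) = e x + e y" by (rule uniq)
    then show "\<epsilon> (x + y) = \<epsilon> x + \<epsilon> y"
      using xy \<open>x + y \<in> h\<close> by (simp add: \<epsilon>_def)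
  next
    fix c x assume x: "x \<in> h"
    then have "c *s x \<in> h" using h by (rule_tac vec.subspace_scale)
    then have "e (c *s x) *s v = (c * e x) *s v"
      using scale[of c x v] e x by (simp add: vector_smult_assoc)
    then have "e (c *s x) = c * e x" by (rule uniq)
    then show "\<epsilon> (c *s x) = c * \<epsilon> x"
      using x \<open>c *s x \<in> h\<close> by (simp add: \<epsilon>_def)
  qed (simp add: \<epsilon>_def)
  moreover have "v \<in> weight_space h \<pi> UNIV \<epsilon>"
    using e by (simp add: weight_space_def \<epsilon>_def)
  ultimately show ?thesis by blast
qed

lemma weight_basis:
  assumes "vec.span (\<Union>\<epsilon>\<in>dual_space h. weight_space h \<pi> UNIV \<epsilon>) = UNIV"
  obtains B \<omega> where "finite B" "vec.independent B" "vec.span B = UNIV"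
    "\<forall>b\<in>B. \<omega> b \<in> dual_space h" "\<forall>b\<in>B. \<forall>x\<in>h. \<pi> x b = \<omega> b x *s b"
proof -
  obtain B where B: "B \<subseteq> (\<Union>\<epsilon>\<in>dual_space h. weight_space h \<pi> UNIV \<epsilon>)" "vec.independent B"
    "(\<Union>\<epsilon>\<in>dual_space h. weight_space h \<pi> UNIV \<epsilon>) \<subseteq> vec.span B"
    by (rule vec.maximal_independent_subset)
  have span: "vec.span B = UNIV"
    using assms vec.span_minimal[OF B(3) vec.subspace_span] by auto
  have "\<forall>b\<in>B. \<exists>\<epsilon>. \<epsilon> \<in> dual_space h \<and> (\<forall>x\<in>h. \<pi> x b = \<epsilon> x *s b)"
    using B(1) by (auto simp: weight_space_def)
  then obtain \<omega> where "\<forall>b\<in>B. \<omega> b \<in> dual_space h \<and> (\<forall>x\<in>h. \<pi> x b = \<omega> b x *s b)"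
    using bchoice[of B "\<lambda>b \<epsilon>. \<epsilon> \<in> dual_space h \<and> (\<forall>x\<in>h. \<pi> x b = \<epsilon> x *s b)"] by blast
  with that[of B \<omega>] B(2) span vec.finiteI_independent[OF B(2)] show ?thesis by blast
qed

text \<open>Compare coefficients in the weight basis: at any \<open>b\<close> where \<open>v\<close>
  has a nonzero coordinate, \<epsilon> must agree with \<open>\<omega> b\<close>. Finiteness of the
  set of weights follows from this.\<close>

lemma weight_occurs_in_weight_basis:
  assumes lin: "\<And>x. Vector_Spaces.linear (*s) (*s) (\<pi> x)"
    and B: "finite B" "vec.independent B" "vec.span B = UNIV"
    and \<omega>: "\<And>b. b \<in> B \<Longrightarrow> \<omega> b \<in> dual_space h"
      "\<And>b x. b \<in> B \<Longrightarrow> x \<in> h \<Longrightarrow> \<pi> x b = \<omega> b x *s b"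
    and \<epsilon>: "\<epsilon> \<in> dual_space h" and v: "v \<noteq> 0" "\<And>x. x \<in> h \<Longrightarrow> \<pi> x v = \<epsilon> x *s v"
  shows "\<exists>b\<in>B. \<epsilon> = \<omega> b"
proof -
  define r where "r = vec.representation B v"
  have rep: "v = (\<Sum>b\<in>B. r b *s b)"
    unfolding r_def using vec.sum_representation_eq[OF B(2) _ B(1), of v] B(3) by simp
  obtain b where b: "b \<in> B" "r b \<noteq> 0"
  proof (rule ccontr)
    assume "\<not> thesis"
    then have "\<forall>b\<in>B. r b = 0" using that by blast
    then have "v = 0" by (subst rep) simp
    then show False using v(1) by simp
  qed
  have "\<epsilon> x = \<omega> b x" if x: "x \<in> h" for x
  proof -
    interpret \<pi>: Vector_Spaces.linear "(*s)" "(*s)" "\<pi> x" by (rule lin)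
    have "(\<Sum>c\<in>B. (r c * \<omega> c x) *s c) = \<pi> x v"
      by (subst rep) (simp add: \<pi>.sum \<pi>.scale \<omega>(2) x vector_smult_assoc cong: sum.cong)
    also have "\<dots> = (\<Sum>c\<in>B. (\<epsilon> x * r c) *s c)"
      unfolding v(2)[OF x] by (subst rep) (simp add: vec.scale_sum_right vector_smult_assoc)
    finally have "(\<Sum>c\<in>B. (r c * \<omega> c x - \<epsilon> x * r c) *s c) = 0"
      by (simp add: vec.scale_left_diff_distrib sum_subtractf)
    then have "r b * \<omega> b x - \<epsilon> x * r b = 0"
      using vec.independentD[OF B(2) B(1) subset_refl,
          where u = "\<lambda>c. r c * \<omega> c x - \<epsilon> x * r c"] b(1) by simp
    then show ?thesis using b by simp
  qed
  then show ?thesis using dual_space_eqI[OF \<epsilon> \<omega>(1)[OF b(1)]] b by blast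
qed

section \<open>Lie algebras with a Cartan subalgebra\<close>

text \<open>In this form \<open>jacobi\<close> says that the adjoint of a bracket is the commutator
  of the adjoints; commuting elements therefore have commuting adjoints.\<close>

locale lie_algebra =
  fixes br :: "('d::finite) bracket"
  assumes add_left: "br (x + y) z = br x z + br y z"
    and scale_left: "br (c *s x) z = c *s br x z"
    and anticommute: "br x y = - br y x"
    and jacobi: "br (br x y) z = br x (br y z) - br y (br x z)"
begin

lemma add_right: "br z (x + y) = br z x + br z y"
  by (metis add_left anticommute minus_add_distrib)

lemma scale_right: "br z (c *s x) = c *s br z x"
  by (metis anticommute scale_left vec.scale_minus_right)

lemma linear_ad: "Vector_Spaces.linear (*s) (*s) (br x)"
  by (simp add: Vector_Spaces.linear_def vec.vector_space_axioms module_hom_axioms_def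
      module_hom_def vec.module_axioms add_right scale_right)

lemma zero_right: "br x 0 = 0" and zero_left: "br 0 x = 0"
  by (metis scale_right vector_smult_lzero) (metis scale_left vector_smult_lzero)

lemma killing_form_eq: "killing_form br x y = (\<Sum>i\<in>UNIV. br x (br y (axis i 1)) $ i)"
proof -
  have "matrix (br x) ** matrix (br y) = matrix (br x \<circ> br y)"
    by (rule matrix_compose_gen[OF linear_ad linear_ad, symmetric])
  then show ?thesis by (simp add: killing_form_def trace_def matrix_def)
qed

lemma killing_form_commute: "killing_form br x y = killing_form br y x"
  unfolding killing_form_def by (rule trace_mul_sym)

lemma killing_form_add_left: "killing_form br (x + y) z = killing_form br x z + killing_form br y z"
  and killing_form_scale_left: "killing_form br (c *s x) z = c * killing_form br x z"
  by (simp_all add: killing_form_eq add_left scale_left sum.distrib sum_distrib_left)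

lemma killing_form_add_right: "killing_form br z (x + y) = killing_form br z x + killing_form br z y"
  and killing_form_scale_right: "killing_form br z (c *s x) = c * killing_form br z x"
  using killing_form_add_left killing_form_scale_left by (metis killing_form_commute)+

lemma killing_form_minus_left: "killing_form br (- x) z = - killing_form br x z"
  using killing_form_scale_left[of "-1" x z] by simp

lemma linear_functional_on_killing_form: "linear_functional_on h (killing_form br x)"
  by (simp add: linear_functional_on_def killing_form_add_right killing_form_scale_right)

text \<open>After expanding both sides with \<open>jacobi\<close>, they differ only by a cyclic
  permutation of three operators under the trace.\<close>

lemma killing_form_invariant: "killing_form br (br x y) z = killing_form br x (br y z)"
proof -
  \<comment> \<open>The trace is taken on functions rather than matrices, so that
    \<open>jacobi\<close> can be applied pointwise inside it.\<close>
  define T where "T = (\<lambda>f :: complex ^ 'd \<Rightarrow> complex ^ 'd. \<Sum>i\<in>UNIV. f (axis i 1) $ i)"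
  have "T (br y \<circ> (br x \<circ> br z)) = T ((br x \<circ> br z) \<circ> br y)"
  proof -
    have xz: "Vector_Spaces.linear (*s) (*s) (br x \<circ> br z)"
      by (rule Vector_Spaces.linear_compose[OF linear_ad linear_ad])
    have "T (br y \<circ> (br x \<circ> br z)) = trace (matrix (br y) ** matrix (br x \<circ> br z))"
      using matrix_compose_gen[OF xz linear_ad, of y, symmetric]
      by (simp add: T_def trace_def matrix_def)
    also have "\<dots> = trace (matrix (br x \<circ> br z) ** matrix (br y))" by (rule trace_mul_sym)
    also have "\<dots> = T ((br x \<circ> br z) \<circ> br y)"
      using matrix_compose_gen[OF linear_ad xz, of y, symmetric]
      by (simp add: T_def trace_def matrix_def)
    finally show ?thesis .
  qed
  moreover have "killing_form br (br x y) z = T (br x \<circ> br y \<circ> br z) - T (br y \<circ> (br x \<circ> br z))"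
    by (simp add: killing_form_eq T_def jacobi sum_subtractf)
  moreover have "br x (u - v) = br x u - br x v" for u v
    by (metis add_diff_cancel add_right diff_add_cancel)
  then have "killing_form br x (br y z) = T (br x \<circ> br y \<circ> br z) - T ((br x \<circ> br z) \<circ> br y)"
    by (simp add: killing_form_eq T_def jacobi sum_subtractf)
  ultimately show ?thesis by simp
qed

end

locale lie_algebra_with_cartan = lie_algebra +
  fixes h :: "(complex ^ 'd) set"
  assumes cartan: "cartan_subalgebra br h"
begin

lemma subspace_cartan: "vec.subspace h"
  and abelian: "x \<in> h \<Longrightarrow> y \<in> h \<Longrightarrow> br x y = 0"
  and self_centralizing: "(\<And>y. y \<in> h \<Longrightarrow> br x y = 0) \<Longrightarrow> x \<in> h"
  and ad_semisimple: "x \<in> h \<Longrightarrow> vec.span {y. \<exists>c. br x y = c *s y} = UNIV"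
  using cartan unfolding cartan_subalgebra_def by blast+

text \<open>Simultaneous diagonalization handles finitely many operators, so it is applied to a
  basis \<open>F\<close> of \<open>h\<close>; having a fixed vector as eigenvector passes to the
  span. Later this acts as an induction principle: a subspace containing all weight vectors is the
  whole algebra.\<close>

lemma span_ad_weight_vectors:
  "vec.span (\<Union>\<epsilon>\<in>dual_space h. weight_space h br UNIV \<epsilon>) = UNIV"
proof -
  obtain F where F: "F \<subseteq> h" "vec.independent F" "h \<subseteq> vec.span F"
    by (rule vec.maximal_independent_subset)
  have "vec.span {v. \<forall>x\<in>F. \<exists>c. br x v = c *s v} = UNIV"
  proof (rule simultaneously_diagonalizable)
    show "finite F" using F(2) by (rule vec.finiteI_independent)
    show "br x (br y v) = br y (br x v)" if "x \<in> F" "y \<in> F" for x y v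
    proof -
      have "br x y = 0" using abelian that F(1) by blast
      then show ?thesis using jacobi[of x y v] by (simp add: zero_left)
    qed
  qed (use F ad_semisimple linear_ad in auto)
  moreover have "{v. \<forall>x\<in>F. \<exists>c. br x v = c *s v} \<subseteq> (\<Union>\<epsilon>\<in>dual_space h. weight_space h br UNIV \<epsilon>)"
  proof
    fix v assume v: "v \<in> {v. \<forall>x\<in>F. \<exists>c. br x v = c *s v}"
    have "vec.subspace {x. \<exists>c. br x v = c *s v}"
    proof (rule vec.subspaceI)
      show "0 \<in> {x. \<exists>c. br x v = c *s v}" by (auto simp: zero_left intro: exI[of _ 0])
    next
      fix x y assume "x \<in> {x. \<exists>c. br x v = c *s v}" "y \<in> {x. \<exists>c. br x v = c *s v}"
      then obtain c d where "br x v = c *s v" "br y v = d *s v" by blast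
      then have "br (x + y) v = (c + d) *s v" by (simp add: add_left vec.scale_left_distrib)
      then show "x + y \<in> {x. \<exists>c. br x v = c *s v}" by blast
    next
      fix k x assume "x \<in> {x. \<exists>c. br x v = c *s v}"
      then obtain c where "br x v = c *s v" by blast
      then have "br (k *s x) v = (k * c) *s v" by (simp add: scale_left vector_smult_assoc)
      then show "k *s x \<in> {x. \<exists>c. br x v = c *s v}" by blast
    qed
    then have "vec.span F \<subseteq> {x. \<exists>c. br x v = c *s v}"
      using v by (intro vec.span_minimal) auto
    then have "\<exists>c. br x v = c *s v" if "x \<in> h" for x using F(3) that by blast
    then show "v \<in> (\<Union>\<epsilon>\<in>dual_space h. weight_space h br UNIV \<epsilon>)"
      using common_eigenvector_has_weight[of br h v] subspace_cartan add_left scale_left by auto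
  qed
  then have "vec.span {v. \<forall>x\<in>F. \<exists>c. br x v = c *s v} \<subseteq>
      vec.span (\<Union>\<epsilon>\<in>dual_space h. weight_space h br UNIV \<epsilon>)" by (rule vec.span_mono)
  ultimately show ?thesis by auto
qed

text \<open>A vector of weight 0 centralizes \<open>h\<close> and so lies in it; a nonzero vector of
  nonzero weight exhibits its weight as a root.\<close>

lemma cartan_or_root_space:
  assumes "\<epsilon> \<in> dual_space h" "v \<in> weight_space h br UNIV \<epsilon>"
  shows "v \<in> h \<or> \<epsilon> \<in> roots br h \<and> v \<in> root_space br h \<epsilon>"
proof (cases "\<epsilon> = 0 \<or> v = 0")
  case True
  then have "br y v = 0" if "y \<in> h" for y
    using assms that by (auto simp: weight_space_def zero_right)
  then have "v \<in> h" using self_centralizing anticommute by (metis neg_equal_0_iff_equal)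
  then show ?thesis ..
next
  case False
  then show ?thesis using assms by (auto simp: roots_def root_space_def weight_space_def)
qed

lemma killing_form_on_cartan:
  assumes "finite B" "vec.independent B" "vec.span B = UNIV"
    and \<omega>: "\<And>b x. b \<in> B \<Longrightarrow> x \<in> h \<Longrightarrow> br x b = \<omega> b x *s b" and xy: "x \<in> h" "y \<in> h"
  shows "killing_form br x y = (\<Sum>b\<in>B. \<omega> b x * \<omega> b y)"
  unfolding killing_form_eq
  by (rule trace_eigenbasis[of "\<lambda>v. br x (br y v)", OF _ assms(1-3)])
    (use Vector_Spaces.linear_compose[OF linear_ad linear_ad, of x y] in
      \<open>auto simp: o_def \<omega> xy scale_right vector_smult_assoc mult.commute\<close>)

text \<open>Moving \<open>x\<close> across the form by invariance scales the same value by
  \<open>- \<epsilon> x\<close> on one side and by \<open>\<delta> x\<close> on the other.\<close>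

lemma killing_form_weight_vectors_orthogonal:
  assumes "v \<in> weight_space h br UNIV \<epsilon>" "w \<in> weight_space h br UNIV \<delta>" "x \<in> h" "\<epsilon> x + \<delta> x \<noteq> 0"
  shows "killing_form br v w = 0"
proof -
  have "killing_form br (br v x) w = killing_form br v (br x w)" by (rule killing_form_invariant)
  moreover have "br v x = - (\<epsilon> x *s v)" "br x w = \<delta> x *s w"
    using assms anticommute[of v x] by (auto simp: weight_space_def)
  ultimately have "- (\<epsilon> x * killing_form br v w) = \<delta> x * killing_form br v w"
    by (simp add: killing_form_minus_left killing_form_scale_left killing_form_scale_right)
  then have "(\<epsilon> x + \<delta> x) * killing_form br v w = 0"
    by (metis add.right_inverse distrib_right)
  then show ?thesis using assms by simp
qed

lemma weight_space_cartan: "x \<in> h \<Longrightarrow> x \<in> weight_space h br UNIV 0"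
  by (simp add: weight_space_def abelian)

end

section \<open>Simple roots and the Killing form\<close>

locale lie_algebra_with_simple_roots = lie_algebra_with_cartan +
  fixes \<Delta> :: "('d::finite) weight set"
  assumes simple: "simple_roots br h \<Delta>"
begin

lemma finite_simple: "finite \<Delta>"
  and simple_subset_roots: "\<Delta> \<subseteq> roots br h"
  and roots_subset_dual: "roots br h \<subseteq> dual_space h"
  using simple by (auto simp: simple_roots_def roots_def)

lemma linear_functional_on_simple: "\<alpha> \<in> \<Delta> \<Longrightarrow> linear_functional_on h \<alpha>"
  using simple_subset_roots roots_subset_dual dual_space_iff by blast

text \<open>The sign \<open>s\<close> merges positive and negative roots into one case. The
  coefficient sum is positive because a root is a nonzero functional.\<close>

lemma root_combination:
  assumes \<beta>: "\<beta> \<in> roots br h"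
  obtains c :: "'d weight \<Rightarrow> nat" and s :: complex
  where "s = 1 \<or> s = -1" "\<forall>x. \<beta> x = s * (\<Sum>\<alpha>\<in>\<Delta>. of_nat (c \<alpha>) * \<alpha> x)" "(\<Sum>\<alpha>\<in>\<Delta>. c \<alpha>) > 0"
proof -
  have "nonneg_combination \<Delta> \<beta> \<or> nonneg_combination \<Delta> (- \<beta>)"
    using \<beta> simple by (auto simp: simple_roots_def)
  then obtain c :: "'d weight \<Rightarrow> nat" and s :: complex
    where s: "s = 1 \<or> s = -1" "\<And>x. s * \<beta> x = (\<Sum>\<alpha>\<in>\<Delta>. of_nat (c \<alpha>) * \<alpha> x)"
  proof
    assume "nonneg_combination \<Delta> \<beta>"
    then show thesis using that[of 1] by (auto simp: nonneg_combination_def)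
  next
    assume "nonneg_combination \<Delta> (- \<beta>)"
    then show thesis using that[of "-1"] by (auto simp: nonneg_combination_def)
  qed
  then have eq: "\<beta> x = s * (\<Sum>\<alpha>\<in>\<Delta>. of_nat (c \<alpha>) * \<alpha> x)" for x
    by (metis mult_minus1 minus_minus mult_1)
  have "(\<Sum>\<alpha>\<in>\<Delta>. c \<alpha>) > 0"
  proof (rule ccontr)
    assume "\<not> ?thesis"
    then have "\<forall>\<alpha>\<in>\<Delta>. c \<alpha> = 0" using finite_simple by simp
    then have "\<beta> x = 0" for x unfolding eq by simp
    then have "\<beta> = 0" by (intro ext) simp
    then show False using \<beta> by (simp add: roots_def)
  qed
  with s(1) eq show ?thesis by (intro that[of s c] allI)
qed

lemma simple_roots_interpolate: "\<exists>x\<in>h. \<forall>\<alpha>\<in>\<Delta>. \<alpha> x = g \<alpha>"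
proof (rule independent_functionals_interpolate[OF finite_simple subspace_cartan])
  fix c \<alpha> assume *: "\<And>x. x \<in> h \<Longrightarrow> (\<Sum>\<alpha>\<in>\<Delta>. c \<alpha> * \<alpha> x) = 0" and \<alpha>: "\<alpha> \<in> \<Delta>"
  \<comment> \<open>Independence in \<open>simple_roots\<close> tests combinations on the whole
    type, whereas here they vanish on \<open>h\<close> only; roots being zero off \<open>h\<close>
    closes the gap.\<close>
  have off: "\<beta> x = 0" if "x \<notin> h" "\<beta> \<in> \<Delta>" for x \<beta>
    using that simple_subset_roots roots_subset_dual dual_space_iff by blast
  have "(\<Sum>\<alpha>\<in>\<Delta>. c \<alpha> * \<alpha> x) = 0" for x
  proof (cases "x \<in> h")
    case False
    show ?thesis by (rule sum.neutral) (use off[OF False] in simp)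
  qed (rule *)
  then have "\<forall>x. (\<Sum>\<alpha>\<in>\<Delta>. c \<alpha> * \<alpha> x) = 0" by (rule allI)
  moreover have "\<forall>c. (\<forall>x. (\<Sum>\<alpha>\<in>\<Delta>. c \<alpha> * \<alpha> x) = 0) \<longrightarrow> (\<forall>\<alpha>\<in>\<Delta>. c \<alpha> = 0)"
    using simple unfolding simple_roots_def by (elim conjE)
  then have "(\<forall>x. (\<Sum>\<alpha>\<in>\<Delta>. c \<alpha> * \<alpha> x) = 0) \<longrightarrow> (\<forall>\<alpha>\<in>\<Delta>. c \<alpha> = 0)" by (rule spec)
  ultimately have "\<forall>\<alpha>\<in>\<Delta>. c \<alpha> = 0" by (rule rev_mp)
  then show "c \<alpha> = 0" using \<alpha> by (rule bspec)
qed (rule linear_functional_on_simple)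

lemma ad_weight_basis:
  obtains B \<omega> where "finite B" "vec.independent B" "vec.span B = UNIV"
    "\<forall>b\<in>B. \<forall>x\<in>h. br x b = \<omega> b x *s b"
    "\<forall>b\<in>B. \<omega> b \<in> roots br h \<or> b \<in> h \<and> \<omega> b = 0"
proof -
  obtain B \<omega> where "finite B" "vec.independent B" "vec.span B = UNIV"
    "\<forall>b\<in>B. \<omega> b \<in> dual_space h" "\<forall>b\<in>B. \<forall>x\<in>h. br x b = \<omega> b x *s b"
    by (rule weight_basis[OF span_ad_weight_vectors])
  note B = this[rule_format]
  have "\<omega> b \<in> roots br h \<or> b \<in> h \<and> \<omega> b = 0" if b: "b \<in> B" for b
  proof -
    have "b \<noteq> 0" using B(2) b vec.dependent_zero by blast
    have "b \<in> weight_space h br UNIV (\<omega> b)" using B(5)[OF b] by (simp add: weight_space_def)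
    with B(4)[OF b] consider "b \<in> h" | "\<omega> b \<in> roots br h"
      using cartan_or_root_space by blast
    then show ?thesis
    proof cases
      case 1
      have "\<omega> b x = 0" if "x \<in> h" for x
        using B(5)[OF b that] abelian[OF that 1] \<open>b \<noteq> 0\<close> by simp
      then have "\<omega> b = 0" by (intro dual_space_eqI[OF B(4)[OF b] dual_space_zero]) simp
      with 1 show ?thesis by simp
    qed simp
  qed
  with that[of B \<omega>] B show ?thesis by blast
qed

text \<open>On the element of \<open>h\<close> at which all simple roots equal \<open>1\<close>, roots take nonzero integer values.\<close>

lemma killing_form_nonzero:
  assumes nonabelian: "br u v \<noteq> 0"
  shows "\<exists>x\<in>h. killing_form br x x \<noteq> 0"
proof -
  obtain B \<omega> where "finite B" "vec.independent B" "vec.span B = UNIV"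
    "\<forall>b\<in>B. \<forall>x\<in>h. br x b = \<omega> b x *s b"
    "\<forall>b\<in>B. \<omega> b \<in> roots br h \<or> b \<in> h \<and> \<omega> b = 0"
    by (rule ad_weight_basis)
  note B = this[rule_format]
  obtain x where "x \<in> h" "\<forall>\<alpha>\<in>\<Delta>. \<alpha> x = 1"
    using simple_roots_interpolate[of "\<lambda>_. 1"] by (rule bexE)
  note x = this[rule_format]
  have "\<exists>n::nat. \<beta> x * \<beta> x = of_nat n \<and> n > 0" if \<beta>: "\<beta> \<in> roots br h" for \<beta>
  proof -
    obtain c :: "'d weight \<Rightarrow> nat" and s :: complex
      where "s = 1 \<or> s = -1" "\<forall>x. \<beta> x = s * (\<Sum>\<alpha>\<in>\<Delta>. of_nat (c \<alpha>) * \<alpha> x)" "(\<Sum>\<alpha>\<in>\<Delta>. c \<alpha>) > 0"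
      by (rule root_combination[OF \<beta>])
      note c = this[rule_format]
    have "(\<Sum>\<alpha>\<in>\<Delta>. of_nat (c \<alpha>) * \<alpha> x) = of_nat (\<Sum>\<alpha>\<in>\<Delta>. c \<alpha>)"
      unfolding of_nat_sum by (intro sum.cong refl) (simp add: x(2))
    then have "\<beta> x = s * of_nat (\<Sum>\<alpha>\<in>\<Delta>. c \<alpha>)" unfolding c(2) by simp
    then have "\<beta> x * \<beta> x = of_nat ((\<Sum>\<alpha>\<in>\<Delta>. c \<alpha>) * (\<Sum>\<alpha>\<in>\<Delta>. c \<alpha>))" using c(1) by auto
    with c(3) show ?thesis by (metis nat_0_less_mult_iff)
  qed
  then have "\<exists>n::nat. \<omega> b x * \<omega> b x = of_nat n \<and> (\<omega> b \<in> roots br h \<longrightarrow> n > 0)" if "b \<in> B" for b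
    using B(5)[OF that] by (metis mult_zero_left of_nat_0 zero_fun_apply)
  then obtain n :: "_ \<Rightarrow> nat" where n: "\<And>b. b \<in> B \<Longrightarrow> \<omega> b x * \<omega> b x = of_nat (n b)"
    "\<And>b. b \<in> B \<Longrightarrow> \<omega> b \<in> roots br h \<Longrightarrow> n b > 0"
    by metis
  \<comment> \<open>Without a root vector in the basis, the whole algebra would lie in the abelian
    \<open>h\<close>. One root is enough to make the sum of nonnegative integers positive.\<close>
  have "\<exists>b\<in>B. \<omega> b \<in> roots br h"
  proof (rule ccontr)
    assume "\<not> ?thesis"
    then have "B \<subseteq> h" using B(5) by blast
    then have "vec.span B \<subseteq> h" using subspace_cartan by (rule vec.span_minimal)
    then have "u \<in> h" "v \<in> h" using B(3) by auto
    then show False using abelian nonabelian by blast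
  qed
  then have "(\<Sum>b\<in>B. n b) > 0" using n(2) B(1) by (auto simp: sum_pos2 intro!: sum_pos2)
  moreover have "killing_form br x x = of_nat (\<Sum>b\<in>B. n b)"
    using killing_form_on_cartan[OF B(1-4) x(1) x(1)] n(1) by simp
  ultimately have "killing_form br x x \<noteq> 0" by (simp only: of_nat_eq_0_iff)
  then show ?thesis using x(1) by blast
qed

text \<open>Describing the real form of \<open>h\<close> by reality of the simple roots, instead of
  spanning it by coroots, makes it available before nondegeneracy is known.\<close>

definition real_cartan :: "(complex ^ 'd) set" where
  "real_cartan = {x \<in> h. \<forall>\<alpha>\<in>\<Delta>. \<alpha> x \<in> \<real>}"

lemma root_real: "\<beta> \<in> roots br h \<Longrightarrow> x \<in> real_cartan \<Longrightarrow> \<beta> x \<in> \<real>"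
proof -
  assume \<beta>: "\<beta> \<in> roots br h" and x: "x \<in> real_cartan"
  obtain c :: "'d weight \<Rightarrow> nat" and s :: complex
    where "s = 1 \<or> s = -1" "\<forall>x. \<beta> x = s * (\<Sum>\<alpha>\<in>\<Delta>. of_nat (c \<alpha>) * \<alpha> x)" "(\<Sum>\<alpha>\<in>\<Delta>. c \<alpha>) > 0"
    by (rule root_combination[OF \<beta>])
    note c = this[rule_format]
  have "(\<Sum>\<alpha>\<in>\<Delta>. of_nat (c \<alpha>) * \<alpha> x) \<in> \<real>"
    using x by (intro sum_in_Reals Reals_mult) (auto simp: real_cartan_def)
  then show ?thesis using c(1,2) by auto
qed

lemma killing_form_real:
  assumes "x \<in> real_cartan" "y \<in> real_cartan"
  shows "killing_form br x y \<in> \<real>"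
proof -
  obtain B \<omega> where "finite B" "vec.independent B" "vec.span B = UNIV"
    "\<forall>b\<in>B. \<forall>x\<in>h. br x b = \<omega> b x *s b"
    "\<forall>b\<in>B. \<omega> b \<in> roots br h \<or> b \<in> h \<and> \<omega> b = 0"
    by (rule ad_weight_basis)
  note B = this[rule_format]
  have "\<omega> b z \<in> \<real>" if "b \<in> B" "z \<in> real_cartan" for b z
    using B(5)[OF that(1)] root_real that(2) by (metis Reals_0 zero_fun_apply)
  moreover have "killing_form br x y = (\<Sum>b\<in>B. \<omega> b x * \<omega> b y)"
    using assms by (intro killing_form_on_cartan[OF B(1-4)]) (auto simp: real_cartan_def)
  ultimately show ?thesis using assms by (auto intro!: sum_in_Reals Reals_mult)
qed

lemma real_cartan_add: "x \<in> real_cartan \<Longrightarrow> y \<in> real_cartan \<Longrightarrow> x + y \<in> real_cartan"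
proof -
  assume xy: "x \<in> real_cartan" "y \<in> real_cartan"
  have "\<alpha> (x + y) \<in> \<real>" if "\<alpha> \<in> \<Delta>" for \<alpha>
  proof -
    have "\<alpha> (x + y) = \<alpha> x + \<alpha> y"
      using linear_functional_on_simple[OF that] xy by (auto simp: real_cartan_def linear_functional_on_def)
    then show ?thesis using xy that by (simp add: real_cartan_def)
  qed
  then show ?thesis using xy subspace_cartan by (simp add: real_cartan_def vec.subspace_add)
qed

lemma zero_in_real_cartan: "0 \<in> real_cartan"
proof -
  have "\<alpha> 0 \<in> \<real>" if "\<alpha> \<in> \<Delta>" for \<alpha>
    using linear_functional_on_zero[OF linear_functional_on_simple[OF that] subspace_cartan] by simp
  then show ?thesis using subspace_cartan by (simp add: real_cartan_def vec.subspace_0)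
qed

end

locale semisimple_lie_algebra = lie_algebra_with_simple_roots br h \<Delta>
  for br :: "('d::finite) bracket" and h \<Delta> +
  assumes nondegenerate: "(\<And>y. killing_form br x y = 0) \<Longrightarrow> x = 0"
begin

text \<open>Elements of \<open>h\<close> have weight 0 and are thus orthogonal to every vector of
  nonzero weight. An element orthogonal to \<open>h\<close> is then orthogonal to all weight
  vectors, which span.\<close>

lemma nondegenerate_on_cartan:
  assumes x: "x \<in> h" and 0: "\<And>y. y \<in> h \<Longrightarrow> killing_form br x y = 0"
  shows "x = 0"
proof (rule nondegenerate)
  fix y
  have "vec.subspace {y. killing_form br x y = 0}"
  proof (rule vec.subspaceI)
    show "0 \<in> {y. killing_form br x y = 0}" using killing_form_scale_right[of x 0 0] by simp
  qed (auto simp: killing_form_add_right killing_form_scale_right)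
  moreover have "(\<Union>\<epsilon>\<in>dual_space h. weight_space h br UNIV \<epsilon>) \<subseteq> {y. killing_form br x y = 0}"
  proof
    fix v assume "v \<in> (\<Union>\<epsilon>\<in>dual_space h. weight_space h br UNIV \<epsilon>)"
    then obtain \<epsilon> where \<epsilon>: "\<epsilon> \<in> dual_space h" "v \<in> weight_space h br UNIV \<epsilon>" by blast
    have "killing_form br x v = 0"
    proof (cases "\<exists>z\<in>h. \<epsilon> z \<noteq> 0")
      case True
      then show ?thesis
        using killing_form_weight_vectors_orthogonal[OF weight_space_cartan[OF x] \<epsilon>(2)] by auto
    next
      case False
      then have "\<epsilon> = 0" using \<epsilon>(1) by (intro dual_space_eqI[OF \<epsilon>(1) dual_space_zero]) auto
      then have "v \<in> h" using cartan_or_root_space[OF \<epsilon>] by (auto simp: roots_def)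
      then show ?thesis by (rule 0)
    qed
    then show "v \<in> {y. killing_form br x y = 0}" by simp
  qed
  ultimately have "vec.span (\<Union>\<epsilon>\<in>dual_space h. weight_space h br UNIV \<epsilon>) \<subseteq> {y. killing_form br x y = 0}"
    by (rule vec.span_minimal[rotated])
  then show "killing_form br x y = 0" using span_ad_weight_vectors by blast
qed

text \<open>All eigenvalues of the adjoint of \<open>x\<close> vanish along with the simple roots,
  so \<open>x\<close> is in the kernel of the Killing form on \<open>h\<close>.\<close>

lemma simple_roots_separate:
  assumes x: "x \<in> h" and 0: "\<And>\<alpha>. \<alpha> \<in> \<Delta> \<Longrightarrow> \<alpha> x = 0"
  shows "x = 0"
proof (rule nondegenerate_on_cartan[OF x])
  fix y assume y: "y \<in> h"
  obtain B \<omega> where "finite B" "vec.independent B" "vec.span B = UNIV"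
    "\<forall>b\<in>B. \<forall>x\<in>h. br x b = \<omega> b x *s b"
    "\<forall>b\<in>B. \<omega> b \<in> roots br h \<or> b \<in> h \<and> \<omega> b = 0"
    by (rule ad_weight_basis)
  note B = this[rule_format]
  have r: "\<beta> x = 0" if \<beta>: "\<beta> \<in> roots br h" for \<beta>
  proof -
    obtain c :: "'d weight \<Rightarrow> nat" and s :: complex
      where "s = 1 \<or> s = -1" "\<forall>x. \<beta> x = s * (\<Sum>\<alpha>\<in>\<Delta>. of_nat (c \<alpha>) * \<alpha> x)" "(\<Sum>\<alpha>\<in>\<Delta>. c \<alpha>) > 0"
      by (rule root_combination[OF \<beta>])
    note c = this(2)[rule_format]
    have "(\<Sum>\<alpha>\<in>\<Delta>. of_nat (c \<alpha>) * \<alpha> x) = 0" by (rule sum.neutral) (simp add: 0)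
    then show ?thesis unfolding c by simp
  qed
  have "\<omega> b x = 0" if "b \<in> B" for b using B(5)[OF that] r by auto
  then show "killing_form br x y = 0" using killing_form_on_cartan[OF B(1-4) x y] by simp
qed

text \<open>These vectors are the fundamental coweights. With them the simple roots become
  coordinates on \<open>h\<close>.\<close>

definition cobasis :: "'d weight \<Rightarrow> complex ^ 'd" where
  "cobasis \<alpha> = (SOME x. x \<in> h \<and> (\<forall>\<beta>\<in>\<Delta>. \<beta> x = (if \<beta> = \<alpha> then 1 else 0)))"

lemma cobasis_in: "cobasis \<alpha> \<in> h"
  and cobasis_dual: "\<beta> \<in> \<Delta> \<Longrightarrow> \<beta> (cobasis \<alpha>) = (if \<beta> = \<alpha> then 1 else 0)"
proof -
  have "\<exists>x. x \<in> h \<and> (\<forall>\<beta>\<in>\<Delta>. \<beta> x = (if \<beta> = \<alpha> then 1 else 0))" for \<alpha>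
    using simple_roots_interpolate[of "\<lambda>\<beta>. if \<beta> = \<alpha> then 1 else 0"] by (simp only: Bex_def)
  then have "cobasis \<alpha> \<in> h \<and> (\<forall>\<beta>\<in>\<Delta>. \<beta> (cobasis \<alpha>) = (if \<beta> = \<alpha> then 1 else 0))" for \<alpha>
    unfolding cobasis_def by (rule someI_ex)
  then have *: "cobasis \<alpha> \<in> h" "\<forall>\<beta>\<in>\<Delta>. \<beta> (cobasis \<alpha>) = (if \<beta> = \<alpha> then 1 else 0)" by simp_all
  show "cobasis \<alpha> \<in> h" by (rule *(1))
  show "\<beta> (cobasis \<alpha>) = (if \<beta> = \<alpha> then 1 else 0)" if "\<beta> \<in> \<Delta>"
    using *(2) that by (rule bspec)
qed

lemma cobasis_combination_in: "(\<Sum>\<alpha>\<in>\<Delta>. c \<alpha> *s cobasis \<alpha>) \<in> h"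
  by (intro vec.subspace_sum vec.subspace_scale subspace_cartan cobasis_in)

lemma functional_cobasis_combination:
  "linear_functional_on h f \<Longrightarrow> f (\<Sum>\<alpha>\<in>\<Delta>. c \<alpha> *s cobasis \<alpha>) = (\<Sum>\<alpha>\<in>\<Delta>. c \<alpha> * f (cobasis \<alpha>))"
  using linear_functional_on_sum[of h f \<Delta> "\<lambda>\<alpha>. c \<alpha> *s cobasis \<alpha>"] subspace_cartan cobasis_in
  by (simp add: linear_functional_on_def vec.subspace_scale)

lemma simple_root_cobasis_combination:
  "\<beta> \<in> \<Delta> \<Longrightarrow> \<beta> (\<Sum>\<alpha>\<in>\<Delta>. c \<alpha> *s cobasis \<alpha>) = c \<beta>"
  using functional_cobasis_combination[OF linear_functional_on_simple] finite_simple
  by (simp add: cobasis_dual if_distrib cong: if_cong)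

text \<open>Both sides have the same values under all simple roots, and these separate the points of
  \<open>h\<close>.\<close>

lemma cobasis_expansion:
  assumes x: "x \<in> h"
  shows "x = (\<Sum>\<alpha>\<in>\<Delta>. \<alpha> x *s cobasis \<alpha>)"
proof -
  have "x - (\<Sum>\<alpha>\<in>\<Delta>. \<alpha> x *s cobasis \<alpha>) = 0"
  proof (rule simple_roots_separate)
    show "x - (\<Sum>\<alpha>\<in>\<Delta>. \<alpha> x *s cobasis \<alpha>) \<in> h"
      by (intro vec.subspace_diff subspace_cartan x cobasis_combination_in)
    show "\<beta> (x - (\<Sum>\<alpha>\<in>\<Delta>. \<alpha> x *s cobasis \<alpha>)) = 0" if "\<beta> \<in> \<Delta>" for \<beta>
      using linear_functional_on_minus[OF linear_functional_on_simple[OF that] subspace_cartan x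
          cobasis_combination_in] simple_root_cobasis_combination[OF that] by simp
  qed
  then show ?thesis by simp
qed

lemma functional_eq_cobasis:
  "linear_functional_on h f \<Longrightarrow> x \<in> h \<Longrightarrow> f x = (\<Sum>\<alpha>\<in>\<Delta>. \<alpha> x * f (cobasis \<alpha>))"
  using functional_cobasis_combination[of f "\<lambda>\<alpha>. \<alpha> x"] cobasis_expansion[of x] by simp

section \<open>Identification of the Cartan subalgebra with its dual by the Killing form\<close>

lemma killing_dual_unique:
  assumes "t \<in> h" "t' \<in> h" "\<And>x. x \<in> h \<Longrightarrow> killing_form br t x = killing_form br t' x"
  shows "t = t'"
proof -
  have "t - t' = 0"
  proof (rule nondegenerate_on_cartan)
    show "t - t' \<in> h" using assms subspace_cartan by (simp add: vec.subspace_diff)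
    show "killing_form br (t - t') x = 0" if "x \<in> h" for x
      using killing_form_add_left[of t "- t'" x] assms(3)[OF that] by (simp add: killing_form_minus_left)
  qed
  then show ?thesis by simp
qed

text \<open>Finding \<open>t\<close> means solving a linear system with the Gram matrix of the
  \<open>cobasis\<close>. Its rows are independent: a relation among them produces an element of
  \<open>h\<close> orthogonal to \<open>h\<close>, which is 0, and applying the simple roots to it
  returns the coefficients.\<close>

lemma killing_dual_exists:
  assumes l: "l \<in> dual_space h"
  shows "\<exists>t\<in>h. \<forall>x\<in>h. killing_form br t x = l x"
proof -
  have "\<exists>t\<in>h. \<forall>\<alpha>\<in>\<Delta>. killing_form br (cobasis \<alpha>) t = l (cobasis \<alpha>)"
  proof (rule independent_functionals_interpolate[OF finite_simple subspace_cartan])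
    fix c \<alpha> assume *: "\<And>x. x \<in> h \<Longrightarrow> (\<Sum>\<alpha>\<in>\<Delta>. c \<alpha> * killing_form br (cobasis \<alpha>) x) = 0" and \<alpha>: "\<alpha> \<in> \<Delta>"
    have "(\<Sum>\<alpha>\<in>\<Delta>. c \<alpha> *s cobasis \<alpha>) = 0"
    proof (rule nondegenerate_on_cartan[OF cobasis_combination_in])
      fix y assume "y \<in> h"
      have "killing_form br (\<Sum>\<alpha>\<in>\<Delta>. c \<alpha> *s cobasis \<alpha>) y = (\<Sum>\<alpha>\<in>\<Delta>. c \<alpha> * killing_form br y (cobasis \<alpha>))"
        unfolding killing_form_commute[of _ y]
        by (rule functional_cobasis_combination[OF linear_functional_on_killing_form])
      also have "\<dots> = (\<Sum>\<alpha>\<in>\<Delta>. c \<alpha> * killing_form br (cobasis \<alpha>) y)"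
        by (intro sum.cong refl arg_cong2[of _ _ _ _ "(*)"] killing_form_commute)
      finally show "killing_form br (\<Sum>\<alpha>\<in>\<Delta>. c \<alpha> *s cobasis \<alpha>) y = 0" using * \<open>y \<in> h\<close> by simp
    qed
    then have "\<alpha> 0 = c \<alpha>" using simple_root_cobasis_combination[OF \<alpha>, of c] by simp
    then show "c \<alpha> = 0"
      using linear_functional_on_zero[OF linear_functional_on_simple[OF \<alpha>] subspace_cartan] by simp
  qed (rule linear_functional_on_killing_form)
  then obtain t where "t \<in> h" "\<forall>\<alpha>\<in>\<Delta>. killing_form br (cobasis \<alpha>) t = l (cobasis \<alpha>)" by (rule bexE)
  note t = this[rule_format]
  have "killing_form br t x = l x" if x: "x \<in> h" for x
  proof -
    have "killing_form br t x = (\<Sum>\<alpha>\<in>\<Delta>. \<alpha> x * killing_form br t (cobasis \<alpha>))"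
      by (rule functional_eq_cobasis[OF linear_functional_on_killing_form x])
    also have "\<dots> = (\<Sum>\<alpha>\<in>\<Delta>. \<alpha> x * l (cobasis \<alpha>))"
      by (intro sum.cong refl) (metis t(2) killing_form_commute)
    also have "\<dots> = l x"
      using functional_eq_cobasis[OF _ x, of l] l by (simp add: dual_space_iff)
    finally show ?thesis .
  qed
  with t(1) show ?thesis by blast
qed

abbreviation t_dual :: "'d weight \<Rightarrow> complex ^ 'd" where "t_dual \<equiv> killing_dual br h"

lemma killing_dual_eqI:
  assumes "t \<in> h" "\<And>x. x \<in> h \<Longrightarrow> killing_form br t x = l x"
  shows "t_dual l = t"
  unfolding killing_dual_def using assms killing_dual_unique by (intro the_equality) auto

lemma killing_dual_in: "l \<in> dual_space h \<Longrightarrow> t_dual l \<in> h"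
  and killing_dual_form: "l \<in> dual_space h \<Longrightarrow> x \<in> h \<Longrightarrow> killing_form br (t_dual l) x = l x"
  using killing_dual_exists killing_dual_eqI by metis+

lemma killing_dual_add:
  assumes "l \<in> dual_space h" "l' \<in> dual_space h"
  shows "t_dual (l + l') = t_dual l + t_dual l'"
  using assms killing_dual_in subspace_cartan
  by (intro killing_dual_eqI) (auto simp: vec.subspace_add killing_form_add_left killing_dual_form)

lemma dual_form_eq:
  assumes "l \<in> dual_space h" "l' \<in> dual_space h"
  shows "dual_form br h l l' = l (t_dual l')"
  using assms killing_dual_in killing_dual_form by (simp add: dual_form_def)

lemma dual_form_commute: "dual_form br h l l' = dual_form br h l' l"
  unfolding dual_form_def by (rule killing_form_commute)

lemma cobasis_in_real_cartan: "cobasis \<alpha> \<in> real_cartan"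
  by (simp add: real_cartan_def cobasis_in cobasis_dual)

text \<open>The coordinates of \<open>t_dual l\<close> solve a linear system whose Gram matrix and
  right-hand side are real. Their imaginary parts solve the homogeneous system and vanish by
  nondegeneracy.\<close>

lemma killing_dual_in_real_cartan:
  assumes l: "l \<in> dual_space h" and real: "\<And>\<alpha>. \<alpha> \<in> \<Delta> \<Longrightarrow> l (cobasis \<alpha>) \<in> \<real>"
  shows "t_dual l \<in> real_cartan"
proof -
  define t where "t = t_dual l"
  have t: "t \<in> h" using l killing_dual_in by (simp add: t_def)
  \<comment> \<open>This is the imaginary part of \<open>t\<close> in \<open>cobasis\<close>
    coordinates; the goal is that it is 0.\<close>
  define y where "y = (\<Sum>\<alpha>\<in>\<Delta>. of_real (Im (\<alpha> t)) *s cobasis \<alpha>)"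
  have yh: "y \<in> h" unfolding y_def by (rule cobasis_combination_in)
  have y0: "killing_form br y (cobasis \<beta>) = 0" if \<beta>: "\<beta> \<in> \<Delta>" for \<beta>
  proof -
    have R: "killing_form br (cobasis \<beta>) (cobasis \<alpha>) = of_real (Re (killing_form br (cobasis \<beta>) (cobasis \<alpha>)))" for \<alpha>
      using killing_form_real cobasis_in_real_cartan by (metis of_real_Re)
    have "killing_form br (cobasis \<beta>) t = (\<Sum>\<alpha>\<in>\<Delta>. \<alpha> t * killing_form br (cobasis \<beta>) (cobasis \<alpha>))"
      by (rule functional_eq_cobasis[OF linear_functional_on_killing_form t])
    then have "Im (killing_form br (cobasis \<beta>) t)
        = (\<Sum>\<alpha>\<in>\<Delta>. Im (\<alpha> t) * Re (killing_form br (cobasis \<beta>) (cobasis \<alpha>)))"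
      by (subst (asm) R) simp
    moreover have "killing_form br (cobasis \<beta>) t \<in> \<real>"
      using killing_dual_form[OF l cobasis_in] real[OF \<beta>] killing_form_commute by (simp add: t_def)
    ultimately have "(\<Sum>\<alpha>\<in>\<Delta>. Im (\<alpha> t) * Re (killing_form br (cobasis \<beta>) (cobasis \<alpha>))) = 0"
      by (simp add: complex_is_Real_iff)
    moreover have "killing_form br (cobasis \<beta>) y
        = of_real (\<Sum>\<alpha>\<in>\<Delta>. Im (\<alpha> t) * Re (killing_form br (cobasis \<beta>) (cobasis \<alpha>)))"
      unfolding y_def functional_cobasis_combination[OF linear_functional_on_killing_form]
      by (subst R) simp
    ultimately show ?thesis by (metis killing_form_commute of_real_0)
  qed
  have "y = 0"
  proof (rule nondegenerate_on_cartan[OF yh])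
    fix x assume x: "x \<in> h"
    have "killing_form br y x = (\<Sum>\<alpha>\<in>\<Delta>. \<alpha> x * killing_form br y (cobasis \<alpha>))"
      by (rule functional_eq_cobasis[OF linear_functional_on_killing_form x])
    then show "killing_form br y x = 0" using y0 by simp
  qed
  then have "of_real (Im (\<alpha> t)) = (0::complex)" if "\<alpha> \<in> \<Delta>" for \<alpha>
    using simple_root_cobasis_combination[OF that, of "\<lambda>\<alpha>. of_real (Im (\<alpha> t))"]
      linear_functional_on_zero[OF linear_functional_on_simple[OF that] subspace_cartan]
    by (simp add: y_def)
  then have "\<alpha> t \<in> \<real>" if "\<alpha> \<in> \<Delta>" for \<alpha>
    using that unfolding complex_is_Real_iff by (metis of_real_eq_0_iff)
  then show ?thesis using t by (simp add: real_cartan_def t_def)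
qed

section \<open>The real form of the dual space and its weights\<close>

definition real_dual :: "'d weight set" where
  "real_dual = {l \<in> dual_space h. t_dual l \<in> real_cartan}"

lemma real_dual_add: "l \<in> real_dual \<Longrightarrow> l' \<in> real_dual \<Longrightarrow> l + l' \<in> real_dual"
  by (simp add: real_dual_def dual_space_add killing_dual_add real_cartan_add)

lemma zero_in_real_dual: "0 \<in> real_dual"
proof -
  have "t_dual 0 = 0"
    using subspace_cartan killing_form_scale_left[of 0 0]
    by (intro killing_dual_eqI) (auto simp: vec.subspace_0)
  then show ?thesis by (simp add: real_dual_def dual_space_zero zero_in_real_cartan)
qed

text \<open>By symmetry of the form, the pairing of \<open>l\<close> with \<alpha> is the value of
  \<alpha> at \<open>t_dual l\<close>, and reality of these values is exactly what
  \<open>real_cartan\<close> demands.\<close>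

lemma real_dualI:
  assumes l: "l \<in> dual_space h" and real: "\<And>\<alpha>. \<alpha> \<in> \<Delta> \<Longrightarrow> dual_form br h l \<alpha> \<in> \<real>"
  shows "l \<in> real_dual"
proof -
  have "\<alpha> (t_dual l) \<in> \<real>" if "\<alpha> \<in> \<Delta>" for \<alpha>
    using real[OF that] dual_form_eq[OF _ l, of \<alpha>] dual_form_commute[of l \<alpha>] that
      simple_subset_roots roots_subset_dual by auto
  then show ?thesis using l killing_dual_in by (auto simp: real_dual_def real_cartan_def)
qed

lemma root_in_real_dual: "\<alpha> \<in> roots br h \<Longrightarrow> \<alpha> \<in> real_dual"
  using killing_dual_in_real_cartan[of \<alpha>] roots_subset_dual root_real cobasis_in_real_cartan
  by (auto simp: real_dual_def)

lemma dual_form_real: "l \<in> real_dual \<Longrightarrow> l' \<in> real_dual \<Longrightarrow> dual_form br h l l' \<in> \<real>"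
  unfolding dual_form_def real_dual_def using killing_form_real by auto

lemma killing_form_definite:
  assumes x: "x \<in> real_cartan" "killing_form br x x = 0"
  shows "x = 0"
proof -
  have xh: "x \<in> h" using x by (simp add: real_cartan_def)
  obtain B \<omega> where "finite B" "vec.independent B" "vec.span B = UNIV"
    "\<forall>b\<in>B. \<forall>x\<in>h. br x b = \<omega> b x *s b"
    "\<forall>b\<in>B. \<omega> b \<in> roots br h \<or> b \<in> h \<and> \<omega> b = 0"
    by (rule ad_weight_basis)
  note B = this[rule_format]
  have real: "\<omega> b x \<in> \<real>" if "b \<in> B" for b
    using B(5)[OF that] root_real x(1) by (metis Reals_0 zero_fun_apply)
  have eq: "killing_form br x x = (\<Sum>b\<in>B. \<omega> b x * \<omega> b x)"
    by (rule killing_form_on_cartan[OF B(1-4) xh xh])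
  have "(\<Sum>b\<in>B. (Re (\<omega> b x))\<^sup>2) = Re (killing_form br x x)"
    unfolding eq Re_sum
    by (intro sum.cong refl) (use real in \<open>auto simp: power2_eq_square complex_is_Real_iff\<close>)
  then have "\<forall>b\<in>B. Re (\<omega> b x) = 0" using x(2) B(1) by (simp add: sum_nonneg_eq_0_iff)
  then have "\<omega> b x = 0" if "b \<in> B" for b
    using that real by (auto simp: complex_is_Real_iff complex_eq_iff)
  then show ?thesis
    using killing_form_on_cartan[OF B(1-4) xh] by (intro nondegenerate_on_cartan[OF xh]) simp
qed

text \<open>The denominator of \<open>cartan_pairing\<close> is nonzero for roots. Division by zero
  yields 0 in HOL, so only with this fact can pairings be converted back into values of
  \<open>dual_form\<close>.\<close>

lemma dual_form_root_nonzero: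
  assumes \<alpha>: "\<alpha> \<in> roots br h"
  shows "dual_form br h \<alpha> \<alpha> \<noteq> 0"
proof
  assume "dual_form br h \<alpha> \<alpha> = 0"
  then have t0: "t_dual \<alpha> = 0"
    using killing_form_definite root_in_real_dual[OF \<alpha>] by (auto simp: dual_form_def real_dual_def)
  have "\<alpha> \<in> dual_space h" using \<alpha> roots_subset_dual by blast
  then have "\<alpha> x = 0" if "x \<in> h" for x
    using killing_dual_form[OF _ that, of \<alpha>] t0 killing_form_scale_left[of 0 0 x] by simp
  then have "\<alpha> = 0" by (intro dual_space_eqI[OF \<open>\<alpha> \<in> dual_space h\<close> dual_space_zero]) simp
  then show False using \<alpha> by (simp add: roots_def)
qed

lemma cartan_pairing_real:
  assumes l: "l \<in> dual_space h" and real: "\<And>\<alpha>. \<alpha> \<in> \<Delta> \<Longrightarrow> cartan_pairing br h l \<alpha> \<in> \<real>"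
  shows "l \<in> real_dual"
proof (rule real_dualI[OF l])
  fix \<alpha> assume \<alpha>: "\<alpha> \<in> \<Delta>"
  then have \<alpha>': "\<alpha> \<in> roots br h" using simple_subset_roots by blast
  have "dual_form br h l \<alpha> = cartan_pairing br h l \<alpha> * dual_form br h \<alpha> \<alpha> / 2"
    using dual_form_root_nonzero[OF \<alpha>'] by (simp add: cartan_pairing_def)
  moreover have "dual_form br h \<alpha> \<alpha> \<in> \<real>"
    by (intro dual_form_real root_in_real_dual \<alpha>')
  ultimately show "dual_form br h l \<alpha> \<in> \<real>"
    using real[OF \<alpha>] by (metis Reals_divide Reals_mult Reals_numeral)
qed

lemma dominant_integral_in_real_dual: "l \<in> dominant_integral_weights br h \<Delta> \<Longrightarrow> l \<in> real_dual"
proof (rule cartan_pairing_real)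
  assume l: "l \<in> dominant_integral_weights br h \<Delta>"
  then show "l \<in> dual_space h" by (simp add: dominant_integral_weights_def)
  show "cartan_pairing br h l \<alpha> \<in> \<real>" if "\<alpha> \<in> \<Delta>" for \<alpha>
    using l that by (auto simp: dominant_integral_weights_def elim!: Nats_cases)
qed

text \<open>The definite description yields information only after existence and uniqueness are
  shown. Existence comes from interpolation by simple roots, uniqueness from their being coordinates
  on \<open>h\<close>.\<close>

lemma fundamental_weight_in_real_dual:
  assumes \<alpha>: "\<alpha> \<in> \<Delta>"
  shows "fundamental_weight br h \<Delta> \<alpha> \<in> real_dual"
proof -
  let ?P = "\<lambda>l. l \<in> dual_space h \<and> (\<forall>\<beta>\<in>\<Delta>. cartan_pairing br h l \<beta> = (if \<beta> = \<alpha> then 1 else 0))"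
  have pairing: "cartan_pairing br h l \<beta> = 2 * \<beta> (t_dual l) / dual_form br h \<beta> \<beta>"
    if "l \<in> dual_space h" "\<beta> \<in> \<Delta>" for l \<beta>
    using that dual_form_eq[of \<beta> l] dual_form_commute[of l \<beta>] simple_subset_roots roots_subset_dual
    by (auto simp: cartan_pairing_def)
  have nz: "dual_form br h \<beta> \<beta> \<noteq> 0" if "\<beta> \<in> \<Delta>" for \<beta>
    using that simple_subset_roots dual_form_root_nonzero by blast
  \<comment> \<open>The value at \<alpha> is half of
    \<open>dual_form br h \<alpha> \<alpha>\<close>, which cancels the factor in
    \<open>cartan_pairing\<close> and gives pairing 1.\<close>
  obtain t where "t \<in> h" "\<forall>\<beta>\<in>\<Delta>. \<beta> t = (if \<beta> = \<alpha> then dual_form br h \<alpha> \<alpha> / 2 else 0)"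
    using simple_roots_interpolate[of "\<lambda>\<beta>. if \<beta> = \<alpha> then dual_form br h \<alpha> \<alpha> / 2 else 0"] by (rule bexE)
  note t = this[rule_format]
  define l where "l = (\<lambda>x. if x \<in> h then killing_form br t x else 0)"
  have l: "l \<in> dual_space h"
    using subspace_cartan unfolding dual_space_def l_def
    by (auto simp: vec.subspace_add vec.subspace_scale killing_form_add_right killing_form_scale_right)
  have "t_dual l = t" using t(1) by (intro killing_dual_eqI) (auto simp: l_def)
  then have "cartan_pairing br h l \<beta> = (if \<beta> = \<alpha> then 1 else 0)" if "\<beta> \<in> \<Delta>" for \<beta>
    using pairing[OF l that] t(2)[OF that] nz[OF that] by (cases "\<beta> = \<alpha>") (simp_all add: field_simps)
  with l have "?P l" by blast
  moreover have "l' = l" if "?P l'" for l'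
  proof -
    have "\<beta> (t_dual l') = \<beta> (t_dual l)" if "\<beta> \<in> \<Delta>" for \<beta>
    proof -
      have "cartan_pairing br h l' \<beta> = cartan_pairing br h l \<beta>"
        using \<open>?P l'\<close> \<open>?P l\<close> \<open>\<beta> \<in> \<Delta>\<close> by simp
      then show ?thesis
        using pairing[OF _ \<open>\<beta> \<in> \<Delta>\<close>] \<open>?P l'\<close> l nz[OF \<open>\<beta> \<in> \<Delta>\<close>] by simp
    qed
    then have "(\<Sum>\<beta>\<in>\<Delta>. \<beta> (t_dual l') *s cobasis \<beta>) = (\<Sum>\<beta>\<in>\<Delta>. \<beta> (t_dual l) *s cobasis \<beta>)"
      by (intro sum.cong refl) simp
    then have eq: "t_dual l' = t_dual l"
      using cobasis_expansion[OF killing_dual_in[OF l]] cobasis_expansion[OF killing_dual_in, of l'] that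
      by simp
    show ?thesis
    proof (rule dual_space_eqI[OF _ l])
      show "l' \<in> dual_space h" using that by blast
      then show "l' x = l x" if "x \<in> h" for x
        using killing_dual_form[OF _ that, of l'] killing_dual_form[OF l that] eq by simp
    qed
  qed
  ultimately have "?P (fundamental_weight br h \<Delta> \<alpha>)"
    unfolding fundamental_weight_def by (rule theI)
  then show ?thesis by (intro cartan_pairing_real) auto
qed

lemma weyl_vector_in_real_dual: "weyl_vector br h \<Delta> \<in> real_dual"
proof -
  have "(\<Sum>\<alpha>\<in>S. fundamental_weight br h \<Delta> \<alpha>) \<in> real_dual" if "S \<subseteq> \<Delta>" for S
    using finite_subset[OF that finite_simple] that
    by (induction S rule: finite_induct)
      (auto simp: zero_in_real_dual real_dual_add fundamental_weight_in_real_dual)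
  then show ?thesis by (simp add: weyl_vector_def)
qed

end

section \<open>Weights of representations\<close>

text \<open>The commutation rule makes \<open>T\<close> a ladder operator for \<open>A\<close> with
  step \<open>g\<close>.\<close>

lemma shifted_eigenvector:
  fixes A T :: "'a::field ^ 'n::finite \<Rightarrow> 'a ^ 'n"
  assumes T: "Vector_Spaces.linear (*s) (*s) T"
    and AT: "\<And>u. A (T u) = T (A u) + g *s T u" and v: "A v = c *s v"
  shows "A ((T ^^ k) v) = (c + of_nat k * g) *s (T ^^ k) v"
proof (induction k)
  case (Suc k)
  interpret T: Vector_Spaces.linear "(*s)" "(*s)" T by (rule T)
  have "A ((T ^^ Suc k) v) = ((c + of_nat k * g) + g) *s (T ^^ Suc k) v"
    unfolding funpow.simps o_apply AT Suc T.scale by (rule vec.scale_left_distrib[symmetric])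
  moreover have "(c + of_nat k * g) + g = c + of_nat (Suc k) * g" by (simp add: algebra_simps)
  ultimately show ?case by simp
qed (simp add: v)

text \<open>A ladder that never reached zero would give \<open>A\<close> infinitely many
  eigenvalues, since multiples of the nonzero \<open>g\<close> are distinct in characteristic
  0.\<close>

lemma ladder_terminates:
  fixes A T :: "'a::field_char_0 ^ 'n::finite \<Rightarrow> 'a ^ 'n"
  assumes A: "Vector_Spaces.linear (*s) (*s) A" and T: "Vector_Spaces.linear (*s) (*s) T"
    and AT: "\<And>u. A (T u) = T (A u) + g *s T u" and v: "A v = c *s v" "v \<noteq> 0" and g: "g \<noteq> 0"
  obtains k where "(T ^^ k) v \<noteq> 0" "T ((T ^^ k) v) = 0"
proof -
  have "\<exists>k. (T ^^ k) v = 0"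
  proof (rule ccontr)
    assume *: "\<nexists>k. (T ^^ k) v = 0"
    have "range (\<lambda>k. c + of_nat k * g) \<subseteq> {d. \<exists>u. u \<noteq> 0 \<and> A u = d *s u}"
    proof
      fix d assume "d \<in> range (\<lambda>k. c + of_nat k * g)"
      then obtain k where d: "d = c + of_nat k * g" by blast
      then have "A ((T ^^ k) v) = d *s (T ^^ k) v" using shifted_eigenvector[OF T AT v(1)] by simp
      then show "d \<in> {d. \<exists>u. u \<noteq> 0 \<and> A u = d *s u}" using * by blast
    qed
    then have "finite (range (\<lambda>k::nat. c + of_nat k * g))"
      using eigenvalues_finite[OF A] by (rule finite_subset)
    moreover have "inj (\<lambda>k::nat. c + of_nat k * g)" using g by (auto simp: inj_def)
    ultimately show False using finite_imageD infinite_UNIV_nat by blast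
  qed
  \<comment> \<open>The least vanishing power is positive because \<open>v\<close> is nonzero; its
    predecessor is the last nonzero rung.\<close>
  then have "(T ^^ (LEAST k. (T ^^ k) v = 0)) v = 0" by (rule LeastI_ex)
  moreover obtain k where "(LEAST k. (T ^^ k) v = 0) = Suc k"
    using calculation v(2) by (cases "LEAST k. (T ^^ k) v = 0") auto
  moreover from this have "(T ^^ k) v \<noteq> 0" using not_less_Least[of k "\<lambda>k. (T ^^ k) v = 0"] by simp
  ultimately show ?thesis using that[of k] by simp
qed

text \<open>
  Starting from the top of the \<open>E\<close>-ladder through \<open>v\<close>, the \<open>F\<close>-ladder has finite length \<open>N\<close>, and
  \<open>E F\<^sup>N w = 0\<close> is a linear equation with real coefficients for the eigenvalue of \<open>A\<close> at the top.
\<close>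

lemma sl2_eigenvalue_real:
  fixes A E F :: "complex ^ 'n::finite \<Rightarrow> complex ^ 'n"
  assumes A: "Vector_Spaces.linear (*s) (*s) A" and E: "Vector_Spaces.linear (*s) (*s) E"
    and F: "Vector_Spaces.linear (*s) (*s) F"
    and AE: "\<And>u. A (E u) = E (A u) + a *s E u" and AF: "\<And>u. A (F u) = F (A u) + (- a) *s F u"
    and EF: "\<And>u. E (F u) = F (E u) + A u"
    and a: "a \<in> \<real>" "a \<noteq> 0" and v: "v \<noteq> 0" "A v = c *s v"
  shows "c \<in> \<real>"
proof -
  interpret F: Vector_Spaces.linear "(*s)" "(*s)" F by (rule F)
  interpret E: Vector_Spaces.linear "(*s)" "(*s)" E by (rule E)
  obtain k where k: "(E ^^ k) v \<noteq> 0" "E ((E ^^ k) v) = 0"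
    by (rule ladder_terminates[OF A E AE v(2) v(1) a(2)])
  define w where "w = (E ^^ k) v"
  define d where "d = c + of_nat k * a"
  have w: "w \<noteq> 0" "E w = 0" "A w = d *s w"
    using k shifted_eigenvector[OF E AE v(2)] by (auto simp: w_def d_def)
  obtain n where n: "(F ^^ n) w \<noteq> 0" "F ((F ^^ n) w) = 0"
    using ladder_terminates[OF A F AF w(3,1)] a(2) by auto
  \<comment> \<open>Moving \<open>E\<close> down through the powers of \<open>F\<close> collects the
    eigenvalues of \<open>A\<close> on the rungs from 0 to \<open>n\<close>; their sum is
    \<open>s n\<close>.\<close>
  define s :: "nat \<Rightarrow> complex" where "s = (\<lambda>n. \<Sum>j\<le>n. d - of_nat j * a)"
  have "E (F ((F ^^ n) w)) = s n *s (F ^^ n) w" for n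
  proof (induction n)
    case 0
    then show ?case by (simp add: EF w s_def)
  next
    case (Suc n)
    have "A ((F ^^ Suc n) w) = (d - of_nat (Suc n) * a) *s (F ^^ Suc n) w"
      using shifted_eigenvector[OF F AF w(3), of "Suc n"] by simp
    then have "E (F ((F ^^ Suc n) w)) = F (s n *s (F ^^ n) w) + (d - of_nat (Suc n) * a) *s (F ^^ Suc n) w"
      using Suc EF[of "(F ^^ Suc n) w"] by simp
    also have "\<dots> = (s n + (d - of_nat (Suc n) * a)) *s (F ^^ Suc n) w"
      by (simp only: F.scale vec.scale_left_distrib funpow.simps o_apply)
    finally show ?case by (simp add: s_def)
  qed
  then have "s n *s (F ^^ n) w = 0" using n(2) by (metis E.zero)
  then have "s n = 0" using n(1) by simp
  \<comment> \<open>The sum \<open>s n\<close> has \<open>Suc n\<close> summands, each contributing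
    one \<open>d\<close>; dividing by this nonzero number makes \<open>d\<close> a real multiple of
    \<open>a\<close>.\<close>
  then have "of_nat (Suc n) * d = (\<Sum>j\<le>n. of_nat j * a)"
    by (simp add: s_def sum_subtractf)
  then have "d = (\<Sum>j\<le>n. of_nat j * a) / of_nat (Suc n)"
    by (metis nonzero_mult_div_cancel_left of_nat_neq_0)
  then have "d \<in> \<real>" using a(1) by (auto intro!: Reals_divide sum_in_Reals Reals_mult simp del: of_nat_Suc)
  then have "d - of_nat k * a \<in> \<real>" using a(1) by (intro Reals_diff Reals_mult) auto
  then show ?thesis by (simp add: d_def)
qed

context semisimple_lie_algebra
begin

text \<open>Nondegeneracy supplies a weight vector pairing nontrivially with \<open>e\<close>, and
  orthogonality forces its weight to be opposite to \<alpha>. No multiplicity of root spaces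
  enters.\<close>

lemma root_vectors_bracket:
  assumes \<alpha>: "\<alpha> \<in> roots br h"
  obtains e f where "\<forall>x\<in>h. br x e = \<alpha> x *s e" "\<forall>x\<in>h. br x f = (- \<alpha> x) *s f" "br e f = t_dual \<alpha>"
proof -
  have \<alpha>d: "\<alpha> \<in> dual_space h" using \<alpha> roots_subset_dual by blast
  have "0 \<in> root_space br h \<alpha>" by (simp add: root_space_def zero_right)
  then obtain e where e: "e \<in> root_space br h \<alpha>" "e \<noteq> 0" using \<alpha> unfolding roots_def by blast
  have "\<exists>\<epsilon>\<in>dual_space h. \<exists>f\<in>weight_space h br UNIV \<epsilon>. killing_form br e f \<noteq> 0"
  proof (rule ccontr)
    assume *: "\<not> ?thesis"
    have "vec.subspace {y. killing_form br e y = 0}"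
    proof (rule vec.subspaceI)
      show "0 \<in> {y. killing_form br e y = 0}" using killing_form_scale_right[of e 0 0] by simp
    qed (auto simp: killing_form_add_right killing_form_scale_right)
    then have "vec.span (\<Union>\<epsilon>\<in>dual_space h. weight_space h br UNIV \<epsilon>) \<subseteq> {y. killing_form br e y = 0}"
      by (intro vec.span_minimal) (use * in auto)
    then have "e = 0" using span_ad_weight_vectors by (intro nondegenerate) blast
    with e(2) show False by simp
  qed
  then obtain \<epsilon> f where f: "f \<in> weight_space h br UNIV \<epsilon>" "killing_form br e f \<noteq> 0" by blast
  have opp: "\<epsilon> x = - \<alpha> x" if "x \<in> h" for x
    using killing_form_weight_vectors_orthogonal[of e \<alpha> f \<epsilon> x] f e(1) that
    by (auto simp: root_space_def weight_space_def eq_neg_iff_add_eq_0 add.commute)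
  \<comment> \<open>With \<open>killing_form br e g = 1\<close>, invariance gives the bracket of
    \<open>e\<close> and \<open>g\<close> exactly the defining property of
    \<open>t_dual \<alpha>\<close>.\<close>
  define g where "g = (1 / killing_form br e f) *s f"
  have g1: "killing_form br e g = 1" using f(2) by (simp add: g_def killing_form_scale_right)
  have ge: "br x e = \<alpha> x *s e" if "x \<in> h" for x using e(1) that by (simp add: root_space_def)
  have gf: "br x g = (- \<alpha> x) *s g" if "x \<in> h" for x
    using f(1) opp[OF that] that by (simp add: weight_space_def g_def scale_right vector_smult_assoc)
  have "br e g = t_dual \<alpha>"
  proof (rule killing_dual_unique[OF _ killing_dual_in[OF \<alpha>d]])
    \<comment> \<open>The opposite weights of \<open>e\<close> and \<open>g\<close> cancel, so their
      bracket centralizes \<open>h\<close>.\<close>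
    show "br e g \<in> h"
    proof (rule self_centralizing)
      fix y assume y: "y \<in> h"
      have "br y (br e g) = br (br y e) g + br e (br y g)" using jacobi[of y e g] by simp
      also have "\<dots> = 0" unfolding ge[OF y] gf[OF y] scale_left scale_right by simp
      finally show "br (br e g) y = 0" using anticommute[of "br e g" y] by simp
    qed
    fix x assume x: "x \<in> h"
    have "br g x = \<alpha> x *s g" using anticommute[of g x] gf[OF x] by simp
    then show "killing_form br (br e g) x = killing_form br (t_dual \<alpha>) x"
      using killing_form_invariant[of e g x] g1 killing_dual_form[OF \<alpha>d x]
      by (simp add: killing_form_scale_right)
  qed
  then show ?thesis using that[of e g] ge gf by blast
qed

text \<open>The images of \<open>e\<close>, \<open>f\<close> and \<open>t_dual \<alpha>\<close>
  under \<pi> satisfy ladder relations, so the weight vector has a real eigenvalue under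
  \<open>t_dual \<alpha>\<close>; this eigenvalue is the pairing of \<epsilon> with
  \<alpha>.\<close>

lemma weight_in_real_dual:
  assumes \<pi>: "lie_representation br \<pi>" and V: "0 \<in> V" and \<epsilon>: "\<epsilon> \<in> weights h \<pi> V"
  shows "\<epsilon> \<in> real_dual"
proof (rule real_dualI)
  show \<epsilon>d: "\<epsilon> \<in> dual_space h" using \<epsilon> by (simp add: weights_def)
  have lin: "Vector_Spaces.linear (*s) (*s) (\<pi> x)" and scale: "\<pi> (c *s x) u = c *s \<pi> x u"
    and hom: "\<pi> (br x y) u = \<pi> x (\<pi> y u) - \<pi> y (\<pi> x u)" for x y u c
    using \<pi> unfolding lie_representation_def by auto
  have ex: "\<exists>v. v \<noteq> 0 \<and> (\<forall>x\<in>h. \<pi> x v = \<epsilon> x *s v)"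
  proof -
    \<comment> \<open>Inequality with \<open>{0}\<close> would also hold for an empty set;
      membership of 0 is what turns it into a nonzero weight vector.\<close>
    have "0 \<in> weight_space h \<pi> V \<epsilon>" using V by (simp add: weight_space_def vec.linear_0[OF lin])
    then obtain v where "v \<in> weight_space h \<pi> V \<epsilon>" "v \<noteq> 0" using \<epsilon> unfolding weights_def by blast
    then show ?thesis by (auto simp: weight_space_def)
  qed
  then obtain v where v: "v \<noteq> 0" "\<forall>x\<in>h. \<pi> x v = \<epsilon> x *s v" by blast
  fix \<alpha> assume "\<alpha> \<in> \<Delta>"
  then have \<alpha>: "\<alpha> \<in> roots br h" and \<alpha>d: "\<alpha> \<in> dual_space h"
    using simple_subset_roots roots_subset_dual by blast+
  obtain e f where ef: "\<forall>x\<in>h. br x e = \<alpha> x *s e" "\<forall>x\<in>h. br x f = (- \<alpha> x) *s f" "br e f = t_dual \<alpha>"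
    by (rule root_vectors_bracket[OF \<alpha>])
  \<comment> \<open>\<open>H\<close> is the Killing dual of \<alpha> rather than the coroot, so the
    ladder step is \<open>dual_form br h \<alpha> \<alpha>\<close> instead of 2.\<close>
  define H where "H = t_dual \<alpha>"
  have H: "H \<in> h" using killing_dual_in[OF \<alpha>d] by (simp add: H_def)
  have aH: "\<alpha> H = dual_form br h \<alpha> \<alpha>" using dual_form_eq[OF \<alpha>d \<alpha>d] by (simp add: H_def)
  have "\<epsilon> H \<in> \<real>"
  proof (rule sl2_eigenvalue_real[OF lin[of H] lin[of e] lin[of f], where v = v and a = "\<alpha> H"])
    show "\<pi> H (\<pi> e u) = \<pi> e (\<pi> H u) + \<alpha> H *s \<pi> e u" for u
      using hom[of H e u] ef(1) H by (simp add: scale)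
    show "\<pi> H (\<pi> f u) = \<pi> f (\<pi> H u) + (- \<alpha> H) *s \<pi> f u" for u
      using hom[of H f u] unfolding bspec[OF ef(2) H] scale[of "- \<alpha> H" f u]
      by (metis add.commute diff_add_cancel)
    show "\<pi> e (\<pi> f u) = \<pi> f (\<pi> e u) + \<pi> H u" for u
      using hom[of e f u] ef(3) by (simp add: H_def)
    show "\<alpha> H \<in> \<real>" "\<alpha> H \<noteq> 0"
      using dual_form_root_nonzero[OF \<alpha>] dual_form_real root_in_real_dual[OF \<alpha>] by (auto simp: aH)
  qed (use v H in auto)
  then show "dual_form br h \<epsilon> \<alpha> \<in> \<real>" using dual_form_eq[OF \<epsilon>d \<alpha>d] by (simp add: H_def)
qed

text \<open>Weight vectors of the algebra shift weights of the module, so the span of the module's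
  weight vectors is invariant. It contains the highest weight vector, hence irreducibility makes it
  all of \<open>V\<close>.\<close>

lemma irreducible_spanned_by_weight_vectors:
  assumes \<pi>: "lie_representation br \<pi>" and V: "irreducible_of_highest_weight br h \<Delta> \<pi> V \<mu>"
  shows "V = vec.span (\<Union>\<epsilon>\<in>dual_space h. weight_space h \<pi> V \<epsilon>)"
proof -
  have lin: "Vector_Spaces.linear (*s) (*s) (\<pi> x)" and scale: "\<pi> (c *s x) u = c *s \<pi> x u"
    and add: "\<pi> (x + y) u = \<pi> x u + \<pi> y u"
    and hom: "\<pi> (br x y) u = \<pi> x (\<pi> y u) - \<pi> y (\<pi> x u)" for x y u c
    using \<pi> unfolding lie_representation_def by auto
  have inv: "invariant_subspace \<pi> V"
    and irr: "\<And>W. invariant_subspace \<pi> W \<Longrightarrow> W \<subseteq> V \<Longrightarrow> W = {0} \<or> W = V"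
    using V unfolding irreducible_of_highest_weight_def irreducible_subrep_def by blast+
  have sub: "vec.subspace V" and stable: "\<And>x v. v \<in> V \<Longrightarrow> \<pi> x v \<in> V"
    using inv unfolding invariant_subspace_def by blast+
  define E where "E = (\<Union>\<epsilon>\<in>dual_space h. weight_space h \<pi> V \<epsilon>)"
  have EV: "E \<subseteq> V" by (auto simp: E_def weight_space_def)
  have step: "\<pi> x v \<in> vec.span E" if v: "v \<in> E" for x v
  proof -
    obtain \<epsilon> where \<epsilon>: "\<epsilon> \<in> dual_space h" "v \<in> V" "\<forall>x\<in>h. \<pi> x v = \<epsilon> x *s v"
      using v by (auto simp: E_def weight_space_def)
    have "vec.subspace {x. \<pi> x v \<in> vec.span E}"
    proof (rule vec.subspaceI)
      show "0 \<in> {x. \<pi> x v \<in> vec.span E}" using scale[of 0 0 v] by (simp add: vec.span_zero)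
    qed (auto simp: add scale vec.span_add vec.span_scale)
    moreover have "(\<Union>\<delta>\<in>dual_space h. weight_space h br UNIV \<delta>) \<subseteq> {x. \<pi> x v \<in> vec.span E}"
    proof
      fix y assume "y \<in> (\<Union>\<delta>\<in>dual_space h. weight_space h br UNIV \<delta>)"
      then obtain \<delta> where \<delta>: "\<delta> \<in> dual_space h" "\<forall>x\<in>h. br x y = \<delta> x *s y"
        by (auto simp: weight_space_def)
      have "\<pi> x (\<pi> y v) = (\<delta> + \<epsilon>) x *s \<pi> y v" if x: "x \<in> h" for x
      proof -
        interpret \<pi>y: Vector_Spaces.linear "(*s)" "(*s)" "\<pi> y" by (rule lin)
        have "\<pi> x (\<pi> y v) = \<pi> (br x y) v + \<pi> y (\<pi> x v)" using hom[of x y v] by simp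
        also have "\<dots> = \<delta> x *s \<pi> y v + \<epsilon> x *s \<pi> y v"
          using bspec[OF \<delta>(2) x] bspec[OF \<epsilon>(3) x] by (simp add: scale \<pi>y.scale)
        finally show ?thesis by (simp add: vec.scale_left_distrib)
      qed
      then have "\<pi> y v \<in> weight_space h \<pi> V (\<delta> + \<epsilon>)" using stable[OF \<epsilon>(2)] by (simp add: weight_space_def)
      then have "\<pi> y v \<in> E" unfolding E_def using dual_space_add[OF \<delta>(1) \<epsilon>(1)] by blast
      then show "y \<in> {x. \<pi> x v \<in> vec.span E}" by (simp add: vec.span_base)
    qed
    ultimately have "vec.span (\<Union>\<delta>\<in>dual_space h. weight_space h br UNIV \<delta>) \<subseteq> {x. \<pi> x v \<in> vec.span E}"
      by (rule vec.span_minimal[rotated])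
    then show ?thesis using span_ad_weight_vectors by blast
  qed
  have "invariant_subspace \<pi> (vec.span E)"
    unfolding invariant_subspace_def
  proof (intro conjI allI ballI)
    fix x v assume v: "v \<in> vec.span E"
    interpret \<pi>x: Vector_Spaces.linear "(*s)" "(*s)" "\<pi> x" by (rule lin)
    have "vec.subspace {v. \<pi> x v \<in> vec.span E}"
    proof (rule vec.subspaceI)
      show "0 \<in> {v. \<pi> x v \<in> vec.span E}" by (simp add: vec.span_zero)
    qed (auto simp: \<pi>x.add \<pi>x.scale vec.span_add vec.span_scale)
    then have "vec.span E \<subseteq> {v. \<pi> x v \<in> vec.span E}"
      by (intro vec.span_minimal) (use step in auto)
    then show "\<pi> x v \<in> vec.span E" using v by blast
  qed (rule vec.subspace_span)
  moreover have "vec.span E \<subseteq> V" using EV sub by (rule vec.span_minimal)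
  ultimately have "vec.span E = {0} \<or> vec.span E = V" by (rule irr)
  moreover have "vec.span E \<noteq> {0}"
  proof -
    obtain v where v: "v \<in> weight_space h \<pi> V \<mu>" "v \<noteq> 0"
      using V unfolding irreducible_of_highest_weight_def by blast
    have "\<exists>c. \<pi> x v = c *s v" if "x \<in> h" for x using v(1) that by (auto simp: weight_space_def)
    \<comment> \<open>Membership of \<mu> in \<open>dual_space h\<close> is not among the
      assumptions here, so a weight for \<open>v\<close> is built anew as a functional on
      \<open>h\<close>.\<close>
    then obtain \<epsilon> where "\<epsilon> \<in> dual_space h" "v \<in> weight_space h \<pi> UNIV \<epsilon>"
      using common_eigenvector_has_weight[of \<pi> h v] add scale subspace_cartan by blast
    then have "v \<in> E" using v(1) by (auto simp: E_def weight_space_def)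
    then have "v \<in> vec.span E" by (rule vec.span_base)
    then show ?thesis using v(2) by blast
  qed
  ultimately show ?thesis by (simp add: E_def)
qed

text \<open>Both claims rest on \<open>full\<close>: the weight vectors in the summands span the
  representation space. They yield a finite weight basis; and if all weights vanish at
  \<open>x\<close>, then \<open>\<pi> x\<close> kills a spanning set, so \<open>x\<close> is 0 by
  injectivity.\<close>

lemma weights_finite_and_separate:
  assumes \<pi>: "lie_representation br \<pi>" "inj \<pi>" and V: "vec.span (\<Union>i\<in>I. V i) = UNIV"
    and irr: "\<And>i. i \<in> I \<Longrightarrow> irreducible_of_highest_weight br h \<Delta> \<pi> (V i) (\<mu> i)"
  shows "0 \<in> U \<Longrightarrow> finite (weights h \<pi> U)"
    and "x \<in> h \<Longrightarrow> (\<And>i \<epsilon>. i \<in> I \<Longrightarrow> \<epsilon> \<in> weights h \<pi> (V i) \<Longrightarrow> \<epsilon> x = 0) \<Longrightarrow> x = 0"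
proof -
  have lin: "Vector_Spaces.linear (*s) (*s) (\<pi> x)" and scale: "\<pi> (c *s x) u = c *s \<pi> x u" for x u c
    using \<pi>(1) unfolding lie_representation_def by auto
  have full: "W = UNIV" if W: "vec.subspace W"
    and E: "\<And>i. i \<in> I \<Longrightarrow> (\<Union>\<epsilon>\<in>dual_space h. weight_space h \<pi> (V i) \<epsilon>) \<subseteq> W" for W
  proof -
    have "V i \<subseteq> W" if i: "i \<in> I" for i
      using vec.span_minimal[OF E[OF i] W]
        irreducible_spanned_by_weight_vectors[OF \<pi>(1) irr[OF i]] by simp
    then have "vec.span (\<Union>i\<in>I. V i) \<subseteq> W" using W by (intro vec.span_minimal) auto
    then show ?thesis using V by auto
  qed
  show "finite (weights h \<pi> U)" if U: "0 \<in> U"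
  proof -
    have "vec.span (\<Union>\<epsilon>\<in>dual_space h. weight_space h \<pi> UNIV \<epsilon>) = UNIV"
    proof (rule full[OF vec.subspace_span])
      fix i
      have "(\<Union>\<epsilon>\<in>dual_space h. weight_space h \<pi> (V i) \<epsilon>) \<subseteq> (\<Union>\<epsilon>\<in>dual_space h. weight_space h \<pi> UNIV \<epsilon>)"
        by (auto simp: weight_space_def)
      also have "\<dots> \<subseteq> vec.span \<dots>" by (rule vec.span_superset)
      finally show "(\<Union>\<epsilon>\<in>dual_space h. weight_space h \<pi> (V i) \<epsilon>)
        \<subseteq> vec.span (\<Union>\<epsilon>\<in>dual_space h. weight_space h \<pi> UNIV \<epsilon>)" .
    qed
    then obtain B \<omega> where B: "finite B" "vec.independent B" "vec.span B = UNIV"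
      "\<forall>b\<in>B. \<omega> b \<in> dual_space h" "\<forall>b\<in>B. \<forall>x\<in>h. \<pi> x b = \<omega> b x *s b"
      by (rule weight_basis)
    have "weights h \<pi> U \<subseteq> \<omega> ` B"
    proof
      fix \<epsilon> assume \<epsilon>: "\<epsilon> \<in> weights h \<pi> U"
      show "\<epsilon> \<in> \<omega> ` B"
      proof -
        have "0 \<in> weight_space h \<pi> U \<epsilon>" using U by (simp add: weight_space_def vec.linear_0[OF lin])
        then obtain v where "v \<in> weight_space h \<pi> U \<epsilon>" "v \<noteq> 0" using \<epsilon> unfolding weights_def by blast
        then have v: "v \<noteq> 0" "\<And>x. x \<in> h \<Longrightarrow> \<pi> x v = \<epsilon> x *s v" by (auto simp: weight_space_def)
        have "\<exists>b\<in>B. \<epsilon> = \<omega> b"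
          using weight_occurs_in_weight_basis[OF lin B(1-3) B(4,5)[rule_format] _ v] \<epsilon>
          by (simp add: weights_def)
        then show ?thesis by blast
      qed
    qed
    then show ?thesis using B(1) by (rule finite_surj[rotated])
  qed
  show "x = 0" if x: "x \<in> h" and 0: "\<And>i \<epsilon>. i \<in> I \<Longrightarrow> \<epsilon> \<in> weights h \<pi> (V i) \<Longrightarrow> \<epsilon> x = 0"
  proof -
    interpret \<pi>x: Vector_Spaces.linear "(*s)" "(*s)" "\<pi> x" by (rule lin)
    have "{v. \<pi> x v = 0} = UNIV"
    proof (rule full)
      show "vec.subspace {v. \<pi> x v = 0}"
      proof (rule vec.subspaceI)
        show "0 \<in> {v. \<pi> x v = 0}" by simp
      qed (auto simp: \<pi>x.add \<pi>x.scale)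
      show "(\<Union>\<epsilon>\<in>dual_space h. weight_space h \<pi> (V i) \<epsilon>) \<subseteq> {v. \<pi> x v = 0}" if i: "i \<in> I" for i
      proof
        fix v assume "v \<in> (\<Union>\<epsilon>\<in>dual_space h. weight_space h \<pi> (V i) \<epsilon>)"
        then obtain \<epsilon> where \<epsilon>: "\<epsilon> \<in> dual_space h" "v \<in> weight_space h \<pi> (V i) \<epsilon>" by blast
        show "v \<in> {v. \<pi> x v = 0}"
        proof (cases "v = 0")
          case False
          then have "\<epsilon> \<in> weights h \<pi> (V i)" using \<epsilon> by (auto simp: weights_def)
          then show ?thesis using 0[OF i] \<epsilon>(2) x by (simp add: weight_space_def)
        qed simp
      qed
    qed
    then have "\<pi> x v = \<pi> 0 v" for v using scale[of 0 0 v] by auto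
    then have "\<pi> x = \<pi> 0" by (rule ext)
    then show ?thesis using \<pi>(2) by (simp add: inj_eq)
  qed
qed

end

section \<open>Complexified simple Lie algebras\<close>

text \<open>Each axiom is an identity for commutators of linear operators, and
  \<open>inj \<pi>\<close> pulls it back to the bracket.\<close>

lemma lie_algebra_of_faithful_representation:
  assumes \<pi>: "lie_representation br \<pi>" "inj \<pi>"
  shows "lie_algebra br"
proof -
  have lin: "Vector_Spaces.linear (*s) (*s) (\<pi> x)" and scale: "\<pi> (c *s x) u = c *s \<pi> x u"
    and add: "\<pi> (x + y) u = \<pi> x u + \<pi> y u"
    and hom: "\<pi> (br x y) u = \<pi> x (\<pi> y u) - \<pi> y (\<pi> x u)" for x y u c
    using \<pi>(1) unfolding lie_representation_def by auto
  have eqI: "x = y" if "\<And>u. \<pi> x u = \<pi> y u" for x y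
    using that injD[OF \<pi>(2)] by blast
  have padd: "\<pi> x (u + v) = \<pi> x u + \<pi> x v" and pdiff: "\<pi> x (u - v) = \<pi> x u - \<pi> x v"
    and pscale: "\<pi> x (c *s u) = c *s \<pi> x u" for x u v c
  proof -
    interpret Vector_Spaces.linear "(*s)" "(*s)" "\<pi> x" by (rule lin)
    show "\<pi> x (u + v) = \<pi> x u + \<pi> x v" "\<pi> x (u - v) = \<pi> x u - \<pi> x v" "\<pi> x (c *s u) = c *s \<pi> x u"
      by (rule add, rule diff, rule scale)
  qed
  have uminus: "\<pi> (- x) u = - \<pi> x u" for x u using scale[of "-1" x u] by simp
  show ?thesis
  proof
    show "br (x + y) z = br x z + br y z" for x y z
      by (rule eqI) (simp add: hom add padd)
    show "br (c *s x) z = c *s br x z" for c x z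
      by (rule eqI) (simp add: hom scale pscale vec.scale_right_diff_distrib)
    show "br x y = - br y x" for x y
      by (rule eqI) (simp add: hom uminus)
    have diff: "\<pi> (x - y) u = \<pi> x u - \<pi> y u" for x y u
      using add[of x "- y" u] uminus[of y u] by simp
    show "br (br x y) z = br x (br y z) - br y (br x z)" for x y z
      by (rule eqI) (simp add: hom diff pdiff)
  qed
qed

definition complex_vec :: "real ^ 'd \<Rightarrow> complex ^ ('d::finite)" where
  "complex_vec X = (\<chi> i. of_real (X $ i))"

lemma complex_vec_decomposition: "z = complex_vec (Re_vec z) + \<i> *s complex_vec (Im_vec z)"
  by (simp add: vec_eq_iff complex_vec_def Re_vec_def Im_vec_def complex_eq[symmetric])

lemma Re_vec_complex_vec: "Re_vec (complex_vec X) = X" and Im_vec_complex_vec: "Im_vec (complex_vec X) = 0"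
  by (simp_all add: vec_eq_iff complex_vec_def Re_vec_def Im_vec_def)

lemma complex_vec_0: "complex_vec 0 = 0"
  by (simp add: vec_eq_iff complex_vec_def)

text \<open>The defining formula contains brackets with zero imaginary parts, and bilinearity of the
  real bracket is not among the assumptions. That these brackets vanish is extracted from the axioms
  of the complexification.\<close>

lemma complexified_bracket_complex_vec:
  fixes br :: "real ^ 'd \<Rightarrow> real ^ 'd \<Rightarrow> real ^ ('d::finite)"
  assumes "lie_algebra (complexified_bracket br)"
  shows "complexified_bracket br (complex_vec X) (complex_vec Y) = complex_vec (br X Y)"
proof -
  interpret lie_algebra "complexified_bracket br" by (rule assms)
  have 1: "br Z 0 = 0" for Z
  proof -
    have "complexified_bracket br (complex_vec Z) (complex_vec 0) = 0" by (simp only: complex_vec_0 zero_right)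
    \<comment> \<open>The real and imaginary parts are the difference and the sum of
      \<open>br Z 0\<close> and \<open>br 0 0\<close>; both vanish, hence so does
      \<open>br Z 0\<close>.\<close>
    then have "\<forall>i. br Z 0 $ i = br 0 0 $ i \<and> br Z 0 $ i + br 0 0 $ i = 0"
      by (simp add: complexified_bracket_def Re_vec_complex_vec Im_vec_complex_vec vec_eq_iff complex_eq_iff)
        (smt (verit))
    then have "br Z 0 $ i = 0" for i by (smt (verit))
    then show ?thesis by (simp add: vec_eq_iff)
  qed
  have 2: "br 0 Z = 0" for Z
  proof -
    have "complexified_bracket br (complex_vec 0) (complex_vec Z) = 0" by (simp only: complex_vec_0 zero_left)
    then have "\<forall>i. br 0 Z $ i = br 0 0 $ i \<and> br 0 0 $ i + br 0 Z $ i = 0"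
      by (simp add: complexified_bracket_def Re_vec_complex_vec Im_vec_complex_vec vec_eq_iff complex_eq_iff)
        (smt (verit))
    then have "br 0 Z $ i = 0" for i by (smt (verit))
    then show ?thesis by (simp add: vec_eq_iff)
  qed
  show ?thesis
    unfolding complexified_bracket_def Re_vec_complex_vec Im_vec_complex_vec 1 2
    by (simp add: complex_vec_def vec_eq_iff complex_eq_iff)
qed

text \<open>
  The real points of the radical of the Killing form are an ideal of the simple real Lie algebra, and
  the Killing form is real on real points, so the radical is the complexification of that ideal.
\<close>

lemma complexified_simple_nondegenerate:
  fixes br :: "real ^ 'd \<Rightarrow> real ^ 'd \<Rightarrow> real ^ ('d::finite)"
  assumes "lie_algebra (complexified_bracket br)" "simple_lie_algebra br"
    and nz: "killing_form (complexified_bracket br) u v \<noteq> 0"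
    and z: "\<And>y. killing_form (complexified_bracket br) z y = 0"
  shows "z = 0"
proof -
  interpret lie_algebra "complexified_bracket br" by (rule assms(1))
  let ?\<kappa> = "killing_form (complexified_bracket br)" and ?C = complex_vec
  note C = complexified_bracket_complex_vec[OF assms(1)]
  have C_add: "?C (X + Y) = ?C X + ?C Y" and C_scale: "?C (k *\<^sub>R X) = of_real k *s ?C X" for X Y k
    by (simp_all add: vec_eq_iff complex_vec_def)
  have axis: "axis i 1 = ?C (axis i 1)" for i by (simp add: vec_eq_iff complex_vec_def axis_def)
  have real: "?\<kappa> (?C X) (?C Y) \<in> \<real>" for X Y
    unfolding killing_form_eq axis C by (intro sum_in_Reals) (simp add: complex_vec_def)
  define R where "R = {X. \<forall>Y. ?\<kappa> (?C X) (?C Y) = 0}"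
  have split: "?\<kappa> x y = ?\<kappa> (?C (Re_vec x)) y + \<i> * ?\<kappa> (?C (Im_vec x)) y" for x y
    using arg_cong[OF complex_vec_decomposition[of x], of "\<lambda>x. ?\<kappa> x y"]
    by (simp only: killing_form_add_left killing_form_scale_left)
  \<comment> \<open>\<open>R\<close> tests orthogonality against real points only; complex linearity
    extends it to every \<open>y\<close>.\<close>
  have R: "?\<kappa> (?C X) y = 0" if "X \<in> R" for X y
  proof -
    have "?\<kappa> (?C Y) (?C X) = 0" for Y
      using that killing_form_commute[of "?C Y" "?C X"] by (simp add: R_def)
    then have "?\<kappa> y (?C X) = 0" using split[of y "?C X"] by simp
    then show ?thesis using killing_form_commute[of "?C X" y] by simp
  qed
  have "subspace R"
  proof (rule subspaceI)
    show "0 \<in> R"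
      using killing_form_scale_left[of 0 0] by (simp add: R_def complex_vec_0)
  qed (auto simp: R_def C_add C_scale killing_form_add_left killing_form_scale_left)
  moreover have "br X Y \<in> R" if "Y \<in> R" for X Y
  proof -
    have "?\<kappa> (?C (br X Y)) y = - ?\<kappa> (?C Y) (complexified_bracket br (?C X) y)" for y
      unfolding C[symmetric]
      by (subst anticommute) (simp add: killing_form_minus_left killing_form_invariant)
    then show ?thesis using R[OF that] by (simp add: R_def)
  qed
  ultimately have "R = {0} \<or> R = UNIV"
    using assms(2) unfolding simple_lie_algebra_def by blast
  moreover have "R \<noteq> UNIV"
  proof
    assume "R = UNIV"
    then have "?\<kappa> (?C X) y = 0" for X y using R by blast
    then have "?\<kappa> u v = 0" using split[of u v] by simp
    then show False using nz by blast
  qed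
  ultimately have R0: "R = {0}" by blast
  \<comment> \<open>Both values are real, so the vanishing of the first plus \<open>\<i>\<close>
    times the second makes each of them vanish.\<close>
  have "?\<kappa> (?C (Re_vec z)) (?C Y) = 0 \<and> ?\<kappa> (?C (Im_vec z)) (?C Y) = 0" for Y
  proof -
    have "?\<kappa> (?C (Re_vec z)) (?C Y) + \<i> * ?\<kappa> (?C (Im_vec z)) (?C Y) = 0"
      using split[of z "?C Y"] z by simp
    with real[of "Re_vec z" Y] real[of "Im_vec z" Y] show ?thesis
      by (auto simp: complex_eq_iff complex_is_Real_iff)
  qed
  then have "Re_vec z \<in> R" "Im_vec z \<in> R" by (simp_all add: R_def)
  then have "Re_vec z = 0" "Im_vec z = 0" using R0 by auto
  then show ?thesis by (simp add: vec_eq_iff Re_vec_def Im_vec_def complex_eq_iff)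
qed

section \<open>Growth of the eigenvalues\<close>

context semisimple_lie_algebra
begin

lemma killing_form_nonneg:
  assumes x: "x \<in> real_cartan"
  shows "Re (killing_form br x x) \<ge> 0"
proof -
  have xh: "x \<in> h" using x by (simp add: real_cartan_def)
  obtain B \<omega> where "finite B" "vec.independent B" "vec.span B = UNIV"
    "\<forall>b\<in>B. \<forall>x\<in>h. br x b = \<omega> b x *s b"
    "\<forall>b\<in>B. \<omega> b \<in> roots br h \<or> b \<in> h \<and> \<omega> b = 0"
    by (rule ad_weight_basis)
  note B = this[rule_format]
  have "\<omega> b x \<in> \<real>" if "b \<in> B" for b
    using B(5)[OF that] root_real x by (metis Reals_0 zero_fun_apply)
  then have "0 \<le> Re (\<omega> b x * \<omega> b x)" if "b \<in> B" for b
    using that by (auto simp: complex_is_Real_iff)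
  moreover have eq: "killing_form br x x = (\<Sum>b\<in>B. \<omega> b x * \<omega> b x)"
    by (rule killing_form_on_cartan[OF B(1-4) xh xh])
  ultimately show ?thesis unfolding eq Re_sum by (intro sum_nonneg) blast
qed

lemma real_dual_apply: "l \<in> real_dual \<Longrightarrow> x \<in> real_cartan \<Longrightarrow> l x \<in> \<real>"
  using killing_form_real[of "t_dual l" x] killing_dual_form[of l x]
  by (auto simp: real_dual_def real_cartan_def)

text \<open>Since the \<open>f s\<close> separate points, each adjoint eigenvalue
  \<open>\<omega> b\<close> is a combination of them. Cauchy-Schwarz bounds its square by the
  weighted sum of squares, and summing over \<open>B\<close> bounds the Killing form.\<close>

lemma separating_weights_bound_killing_form:
  fixes w :: "'s \<Rightarrow> real"
  assumes S: "finite S" and f: "\<And>s. s \<in> S \<Longrightarrow> f s \<in> real_dual" and w: "\<And>s. s \<in> S \<Longrightarrow> w s > 0"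
    and sep: "\<And>x. x \<in> h \<Longrightarrow> (\<And>s. s \<in> S \<Longrightarrow> f s x = 0) \<Longrightarrow> x = 0"
  obtains C where "C > 0"
    "\<forall>x\<in>real_cartan. Re (killing_form br x x) \<le> C * (\<Sum>s\<in>S. w s * (Re (f s x))\<^sup>2)"
proof -
  obtain B \<omega> where "finite B" "vec.independent B" "vec.span B = UNIV"
    "\<forall>b\<in>B. \<forall>x\<in>h. br x b = \<omega> b x *s b"
    "\<forall>b\<in>B. \<omega> b \<in> roots br h \<or> b \<in> h \<and> \<omega> b = 0"
    by (rule ad_weight_basis)
  note B = this[rule_format]
  have ex: "\<exists>C\<ge>0. \<forall>x\<in>real_cartan. Re (\<omega> b x * \<omega> b x) \<le> C * (\<Sum>s\<in>S. w s * (Re (f s x))\<^sup>2)"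
    if b: "b \<in> B" for b
  proof -
    have \<omega>: "\<omega> b \<in> dual_space h"
      using B(5)[OF b] roots_subset_dual dual_space_zero by auto
    have "\<exists>c. \<forall>x\<in>h. \<omega> b x = (\<Sum>s\<in>S. c s * f s x)"
    proof (rule functional_in_span_of_common_kernel[OF S subspace_cartan])
      show "linear_functional_on h (f s)" if "s \<in> S" for s
        using f[OF that] by (simp add: real_dual_def dual_space_iff)
      show "linear_functional_on h (\<omega> b)" using \<omega> by (simp add: dual_space_iff)
      then show "\<omega> b x = 0" if "x \<in> h" "\<And>s. s \<in> S \<Longrightarrow> f s x = 0" for x
        using sep[OF that] linear_functional_on_zero subspace_cartan by blast
    qed
    then obtain c where "\<forall>x\<in>h. \<omega> b x = (\<Sum>s\<in>S. c s * f s x)" by (rule exE)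
    note c = this[rule_format]
    show ?thesis
    \<comment> \<open>Cauchy-Schwarz is applied after multiplying and dividing by
      \<open>sqrt (w s)\<close>, which puts the weights on the side of \<open>f\<close>. Only real
      parts of the coefficients count, because \<open>f s x\<close> is real.\<close>
    proof (intro exI[of _ "\<Sum>s\<in>S. (Re (c s) / sqrt (w s))\<^sup>2"] conjI ballI)
      show "0 \<le> (\<Sum>s\<in>S. (Re (c s) / sqrt (w s))\<^sup>2)" by (intro sum_nonneg) simp
      fix x assume x: "x \<in> real_cartan"
      then have xh: "x \<in> h" by (simp add: real_cartan_def)
      have Im0: "Im (f s x) = 0" if "s \<in> S" for s
        using real_dual_apply[OF f[OF that] x] by (simp add: complex_is_Real_iff)
      have Re_\<omega>: "Re (\<omega> b x) = (\<Sum>s\<in>S. (Re (c s) / sqrt (w s)) * (sqrt (w s) * Re (f s x)))"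
        unfolding c[OF xh] Re_sum
      proof (intro sum.cong refl)
        fix s assume s: "s \<in> S"
        then show "Re (c s * f s x) = (Re (c s) / sqrt (w s)) * (sqrt (w s) * Re (f s x))"
          using w[OF s] Im0[OF s] by simp
      qed
      have "Re (\<omega> b x * \<omega> b x) \<le> (Re (\<omega> b x))\<^sup>2" by (simp add: power2_eq_square)
      also have "\<dots> \<le> (\<Sum>s\<in>S. (Re (c s) / sqrt (w s))\<^sup>2) * (\<Sum>s\<in>S. (sqrt (w s) * Re (f s x))\<^sup>2)"
        unfolding Re_\<omega> by (rule Cauchy_Schwarz_ineq_sum)
      also have "(\<Sum>s\<in>S. (sqrt (w s) * Re (f s x))\<^sup>2) = (\<Sum>s\<in>S. w s * (Re (f s x))\<^sup>2)"
        by (intro sum.cong refl) (use w in \<open>simp add: power_mult_distrib less_imp_le\<close>)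
      finally show "Re (\<omega> b x * \<omega> b x)
        \<le> (\<Sum>s\<in>S. (Re (c s) / sqrt (w s))\<^sup>2) * (\<Sum>s\<in>S. w s * (Re (f s x))\<^sup>2)" .
    qed
  qed
  then have "\<forall>b\<in>B. \<exists>C. C \<ge> 0 \<and>
      (\<forall>x\<in>real_cartan. Re (\<omega> b x * \<omega> b x) \<le> C * (\<Sum>s\<in>S. w s * (Re (f s x))\<^sup>2))" by blast
  then obtain C where "\<forall>b\<in>B. C b \<ge> 0 \<and>
      (\<forall>x\<in>real_cartan. Re (\<omega> b x * \<omega> b x) \<le> C b * (\<Sum>s\<in>S. w s * (Re (f s x))\<^sup>2))"
    by (rule bchoice[THEN exE])
  then have C: "C b \<ge> 0" "x \<in> real_cartan \<Longrightarrow> Re (\<omega> b x * \<omega> b x) \<le> C b * (\<Sum>s\<in>S. w s * (Re (f s x))\<^sup>2)"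
    if "b \<in> B" for b x using that by blast+
  show ?thesis
  \<comment> \<open>Adding 1 makes the constant strictly positive even if every \<open>C b\<close>
    is 0.\<close>
  proof (rule that[of "1 + (\<Sum>b\<in>B. C b)"])
    have C0: "0 \<le> (\<Sum>b\<in>B. C b)" using C(1) by (rule sum_nonneg)
    then show "0 < 1 + (\<Sum>b\<in>B. C b)" by simp
    show "\<forall>x\<in>real_cartan. Re (killing_form br x x)
      \<le> (1 + (\<Sum>b\<in>B. C b)) * (\<Sum>s\<in>S. w s * (Re (f s x))\<^sup>2)"
    proof
      fix x assume x: "x \<in> real_cartan"
      then have xh: "x \<in> h" by (simp add: real_cartan_def)
      let ?Q = "\<Sum>s\<in>S. w s * (Re (f s x))\<^sup>2"
      have Q0: "0 \<le> ?Q" using w by (intro sum_nonneg) (simp add: less_imp_le)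
      have eq: "killing_form br x x = (\<Sum>b\<in>B. \<omega> b x * \<omega> b x)"
        by (rule killing_form_on_cartan[OF B(1-4) xh xh])
      have "Re (killing_form br x x) \<le> (\<Sum>b\<in>B. C b * ?Q)"
        unfolding eq Re_sum using C(2)[OF _ x] by (rule sum_mono)
      also have "\<dots> = (\<Sum>b\<in>B. C b) * ?Q" by (rule sum_distrib_right[symmetric])
      also have "\<dots> \<le> (1 + (\<Sum>b\<in>B. C b)) * ?Q" using Q0 by (intro mult_right_mono) auto
      finally show "Re (killing_form br x x) \<le> (1 + (\<Sum>b\<in>B. C b)) * ?Q" .
    qed
  qed
qed

text \<open>The right side minus the left is the value of the form at \<open>a + b + b\<close>,
  which is nonnegative. With \<open>b\<close> the dual of \<rho>, this passes from the shifted
  weight back to the weight itself.\<close>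

lemma killing_form_parallelogram_bound:
  assumes "a \<in> real_cartan" "b \<in> real_cartan"
  shows "Re (killing_form br a a) \<le> 2 * Re (killing_form br (a + b) (a + b)) + 2 * Re (killing_form br b b)"
proof -
  have "a + b + b \<in> real_cartan" using assms by (intro real_cartan_add)
  then have "0 \<le> Re (killing_form br (a + b + b) (a + b + b))" by (rule killing_form_nonneg)
  then show ?thesis
    by (simp only: killing_form_add_left killing_form_add_right killing_form_commute[of b a] plus_complex.sel)
      simp
qed

end

section \<open>The q-number on real arguments and its quadratic growth\<close>

definition real_q_number :: "real \<Rightarrow> real \<Rightarrow> real" where
  "real_q_number q x = (q powr x - q powr (- x)) / (q - inverse q)"

lemma q_number_of_real: "0 < q \<Longrightarrow> q_number q (of_real x) = of_real (real_q_number q x)"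
  using powr_of_real[of q x] powr_of_real[of q "- x"]
  by (simp add: q_number_def real_q_number_def)

text \<open>With \<open>t = x * ln q\<close> the numerator is \<open>exp t - exp (- t)\<close>,
  whose absolute value is at least that of \<open>t\<close>. Squaring removes the signs of the
  logarithm and the denominator.\<close>

lemma real_q_number_growth:
  assumes "0 < q"
  shows "(ln q / (q - inverse q))\<^sup>2 * x\<^sup>2 \<le> (real_q_number q x)\<^sup>2"
proof -
  have exp_diff: "t \<le> exp t - exp (- t)" if "t \<ge> 0" for t :: real
    using exp_ge_add_one_self[of t] that exp_le_one_iff[of "- t"] by linarith
  have "\<bar>t\<bar> \<le> \<bar>exp t - exp (- t)\<bar>" for t :: real
    using exp_diff[of t] exp_diff[of "- t"] by (cases "t \<ge> 0") auto
  from this[of "x * ln q"] have "(x * ln q)\<^sup>2 \<le> (q powr x - q powr (- x))\<^sup>2"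
    using assms by (simp add: powr_def abs_le_square_iff)
  then have "(x * ln q)\<^sup>2 / (q - inverse q)\<^sup>2 \<le> (q powr x - q powr (- x))\<^sup>2 / (q - inverse q)\<^sup>2"
    by (rule divide_right_mono) simp
  then show ?thesis by (simp add: real_q_number_def power_divide power_mult_distrib mult.commute)
qed

context semisimple_lie_algebra
begin

lemma laplacian_eigenvalue_bounded_below_and_proper:
  fixes \<pi> :: "complex ^ 'd \<Rightarrow> complex ^ 'n \<Rightarrow> complex ^ ('n::finite)" and a :: "nat \<Rightarrow> real"
  assumes q: "0 < q" "q < 1" and a: "\<And>i. i \<in> {1..m} \<Longrightarrow> 0 < a i"
    and \<pi>: "lie_representation br \<pi>" "inj \<pi>" and V: "direct_sum_decomposition {1..m} V"
    and irr: "\<And>i. i \<in> {1..m} \<Longrightarrow> irreducible_of_highest_weight br h \<Delta> \<pi> (V i) (\<mu> i)"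
  defines "P \<equiv> dominant_integral_weights br h \<Delta>"
    and "C\<^sub>Z \<equiv> laplacian_eigenvalue q br h \<Delta> \<pi> m V a"
  shows "(\<forall>l\<in>P. C\<^sub>Z l \<in> \<real>) \<and>
         (\<exists>L::real. \<forall>l\<in>P. L \<le> Re (C\<^sub>Z l)) \<and>
         filterlim (\<lambda>l. Re (C\<^sub>Z l)) at_top
           (inf (filtercomap (\<lambda>l. Re (dual_form br h l l)) at_top) (principal P))"
proof -
  \<comment> \<open>Pairing each weight with its summand keeps a weight shared by several
    \<open>V i\<close> as separate terms, so the double sum becomes one sum with weights
    \<open>w\<close> absorbing \<open>a i\<close> and the multiplicity.\<close>
  define S where "S = (SIGMA i:{1..m}. weights h \<pi> (V i))"
  define w :: "nat \<times> 'd weight \<Rightarrow> real"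
    where "w = (\<lambda>s. a (fst s) * real (weight_multiplicity h \<pi> (V (fst s)) (snd s)))"
  define \<rho> where "\<rho> = weyl_vector br h \<Delta>"
  have span: "vec.span (\<Union>i\<in>{1..m}. V i) = UNIV"
    using V by (simp add: direct_sum_decomposition_def)
  have V0: "0 \<in> V i" if "i \<in> {1..m}" for i
    using V that unfolding direct_sum_decomposition_def by (blast intro: vec.subspace_0)
  have fin: "finite (weights h \<pi> (V i))" if "i \<in> {1..m}" for i
    by (rule weights_finite_and_separate(1)[OF \<pi> span irr V0[OF that]])
  have finS: "finite S" unfolding S_def using fin by (intro finite_SigmaI) auto
  have real: "snd s \<in> real_dual" if "s \<in> S" for s
    using that weight_in_real_dual[OF \<pi>(1) V0] by (auto simp: S_def)
  have wpos: "w s > 0" if s: "s \<in> S" for s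
  proof -
    obtain i \<epsilon> where i: "s = (i, \<epsilon>)" "i \<in> {1..m}" "\<epsilon> \<in> weights h \<pi> (V i)" using s by (auto simp: S_def)
    have "weight_multiplicity h \<pi> (V i) \<epsilon> > 0"
    proof (rule ccontr)
      assume "\<not> ?thesis"
      then have "weight_space h \<pi> (V i) \<epsilon> \<subseteq> {0}" by (simp add: weight_multiplicity_def)
      moreover have "0 \<in> weight_space h \<pi> (V i) \<epsilon>"
        using V0[OF i(2)] \<pi>(1) by (simp add: weight_space_def lie_representation_def vec.linear_0)
      ultimately show False using i(3) by (auto simp: weights_def)
    qed
    then show ?thesis using a[OF i(2)] by (simp add: w_def i(1))
  qed
  have sep: "x = 0" if "x \<in> h" "\<And>s. s \<in> S \<Longrightarrow> snd s x = 0" for x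
  proof (rule weights_finite_and_separate(2)[OF \<pi> span irr that(1)])
    fix i \<epsilon> assume "i \<in> {1..m}" "\<epsilon> \<in> weights h \<pi> (V i)"
    then show "\<epsilon> x = 0" using that(2)[of "(i, \<epsilon>)"] by (simp add: S_def)
  qed
  obtain C where C: "C > 0"
    "\<forall>x\<in>real_cartan. Re (killing_form br x x) \<le> C * (\<Sum>s\<in>S. w s * (Re (snd s x))\<^sup>2)"
    by (rule separating_weights_bound_killing_form[OF finS real wpos sep])
  have \<rho>: "\<rho> \<in> real_dual" unfolding \<rho>_def by (rule weyl_vector_in_real_dual)
  define Q :: "'d weight \<Rightarrow> nat \<times> 'd weight \<Rightarrow> real"
    where "Q = (\<lambda>l s. (real_q_number q (Re (snd s (t_dual l))))\<^sup>2)"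
  \<comment> \<open>This collects the subtracted terms of the eigenvalue; \<open>- M\<close> will be
    the lower bound.\<close>
  define M where "M = (\<Sum>s\<in>S. w s * Q \<rho> s)"
  define k where "k = (ln q / (q - inverse q))\<^sup>2"
  \<comment> \<open>Strictness keeps the denominator in \<open>k\<close> away from zero, and
    \<open>ln q\<close> is nonzero because \<open>q\<close> is below 1.\<close>
  have "q < inverse q" using q one_less_inverse[of q] by linarith
  then have k: "k > 0" using q by (simp add: k_def)
  have qn: "(q_number q (dual_form br h l (snd s)))\<^sup>2 = of_real (Q l s)"
    if l: "l \<in> real_dual" and s: "s \<in> S" for l s
  proof -
    have "dual_form br h l (snd s) = snd s (t_dual l)"
      using dual_form_eq[of "snd s" l] dual_form_commute[of l] l real[OF s] by (simp add: real_dual_def)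
    also have "\<dots> = of_real (Re (snd s (t_dual l)))"
      using real_dual_apply[OF real[OF s], of "t_dual l"] l by (simp add: real_dual_def)
    finally show ?thesis using q by (simp add: q_number_of_real Q_def)
  qed
  have eigenvalue: "C\<^sub>Z l = of_real ((\<Sum>s\<in>S. w s * Q (l + \<rho>) s) - M)" if l: "l \<in> real_dual" for l
  proof -
    have "C\<^sub>Z l = (\<Sum>s\<in>S. of_real (w s) * ((q_number q (dual_form br h (l + \<rho>) (snd s)))\<^sup>2
        - (q_number q (dual_form br h \<rho> (snd s)))\<^sup>2))"
      unfolding C\<^sub>Z_def laplacian_eigenvalue_def S_def \<rho>_def[symmetric] sum_distrib_left
      by (subst sum.Sigma) (use fin in \<open>auto simp: w_def split_beta intro!: sum.cong\<close>)
    also have "\<dots> = (\<Sum>s\<in>S. of_real (w s * Q (l + \<rho>) s - w s * Q \<rho> s))"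
      by (intro sum.cong refl) (simp add: qn real_dual_add l \<rho> right_diff_distrib)
    also have "\<dots> = of_real ((\<Sum>s\<in>S. w s * Q (l + \<rho>) s) - M)"
      by (simp add: M_def sum_subtractf)
    finally show ?thesis .
  qed
  have lower: "k * (\<Sum>s\<in>S. w s * (Re (snd s (t_dual (l + \<rho>))))\<^sup>2) - M \<le> Re (C\<^sub>Z l)"
    if l: "l \<in> real_dual" for l
  proof -
    have "k * (w s * (Re (snd s (t_dual (l + \<rho>))))\<^sup>2) \<le> w s * Q (l + \<rho>) s" if s: "s \<in> S" for s
      using mult_left_mono[OF real_q_number_growth[OF q(1)] less_imp_le[OF wpos[OF s]]]
      unfolding k_def Q_def by (simp only: mult.left_commute)
    then have "k * (\<Sum>s\<in>S. w s * (Re (snd s (t_dual (l + \<rho>))))\<^sup>2) \<le> (\<Sum>s\<in>S. w s * Q (l + \<rho>) s)"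
      unfolding sum_distrib_left by (rule sum_mono)
    then show ?thesis by (simp add: eigenvalue[OF l])
  qed
  have PR: "l \<in> real_dual" if "l \<in> P" for l
    using that dominant_integral_in_real_dual by (simp add: P_def)
  have "\<forall>l\<in>P. C\<^sub>Z l \<in> \<real>" using eigenvalue PR by simp
  moreover have "\<forall>l\<in>P. - M \<le> Re (C\<^sub>Z l)"
  proof
    fix l assume "l \<in> P"
    have "0 \<le> k * (\<Sum>s\<in>S. w s * (Re (snd s (t_dual (l + \<rho>))))\<^sup>2)"
      using k wpos by (intro mult_nonneg_nonneg sum_nonneg) (auto simp: less_imp_le)
    then show "- M \<le> Re (C\<^sub>Z l)" using lower[OF PR[OF \<open>l \<in> P\<close>]] by linarith
  qed
  moreover have "filterlim (\<lambda>l. Re (C\<^sub>Z l)) at_top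
      (inf (filtercomap (\<lambda>l. Re (dual_form br h l l)) at_top) (principal P))"
    unfolding filterlim_at_top
  proof
    fix Z :: real
    define R where "R = Re (killing_form br (t_dual \<rho>) (t_dual \<rho>))"
    \<comment> \<open>This solves the chain backwards: the eigenvalue reaches \<open>Z\<close> once
      \<open>k * ?T\<close> reaches \<open>Z + M\<close>, while \<open>dual_form br h l l\<close> is
      at most \<open>2 * C * ?T + 2 * R\<close>.\<close>
    define N where "N = 2 * C * ((Z + M) / k) + 2 * R"
    have "Z \<le> Re (C\<^sub>Z l)" if N: "N \<le> Re (dual_form br h l l)" and "l \<in> P" for l
    proof -
      have l: "l \<in> real_dual" using PR \<open>l \<in> P\<close> .
      let ?t = "t_dual (l + \<rho>)" and ?T = "\<Sum>s\<in>S. w s * (Re (snd s (t_dual (l + \<rho>))))\<^sup>2"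
      have t: "?t = t_dual l + t_dual \<rho>" using l \<rho> by (simp add: real_dual_def killing_dual_add)
      have "?t \<in> real_cartan" using real_dual_add[OF l \<rho>] by (simp add: real_dual_def)
      then have "Re (killing_form br ?t ?t) \<le> C * ?T" using C(2) by blast
      moreover have "Re (dual_form br h l l) \<le> 2 * Re (killing_form br ?t ?t) + 2 * R"
        unfolding t R_def dual_form_def
        using l \<rho> by (intro killing_form_parallelogram_bound) (simp_all add: real_dual_def)
      ultimately have "C * ((Z + M) / k) \<le> C * ?T" using N by (simp add: N_def)
      then have "(Z + M) / k \<le> ?T" using C(1) by (simp only: mult_le_cancel_left_pos)
      then have "Z + M \<le> k * ?T" using k by (simp add: pos_divide_le_eq mult.commute)
      then show ?thesis using lower[OF l] by linarith
    qed
    then show "\<forall>\<^sub>F l in inf (filtercomap (\<lambda>l. Re (dual_form br h l l)) at_top) (principal P). Z \<le> Re (C\<^sub>Z l)"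
      unfolding eventually_inf_principal eventually_filtercomap_at_top_linorder by blast
  qed
  ultimately show ?thesis by blast
qed

end

theorem proposition9p1p1:
  fixes K :: "('k::t2_space) monoid"
    and A :: "('k, 'd::finite) chart set" and c :: "('k, 'd) chart"
    and \<gg> :: "'d bracket" and h :: "(complex ^ 'd) set" and \<Delta> :: "'d weight set"
    and q :: real and m :: nat and \<mu> :: "nat \<Rightarrow> 'd weight" and a :: "nat \<Rightarrow> real"
    and \<pi> :: "complex ^ 'd \<Rightarrow> complex ^ 'n \<Rightarrow> complex ^ ('n::finite)"
    and V :: "nat \<Rightarrow> (complex ^ 'n) set"
  defines "P \<equiv> dominant_integral_weights \<gg> h \<Delta>"
    and "w\<^sub>0 \<equiv> longest_element \<gg> h \<Delta>"
    and "C\<^sub>Z \<equiv> laplacian_eigenvalue q \<gg> h \<Delta> \<pi> m V a"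
  assumes "lie_group K A" "compact (carrier K)" "simply_connected (carrier K)"
    and "c \<in> A" "\<one>\<^bsub>K\<^esub> \<in> fst c" "simple_lie_algebra (lie_bracket K c)"
    and "\<gg> = complexified_bracket (lie_bracket K c)"
    and "cartan_subalgebra \<gg> h" "simple_roots \<gg> h \<Delta>"
    and "0 < q" "q < 1"
    and "\<forall>l\<in>{1..m}. \<mu> l \<in> P" "inj_on \<mu> {1..m}" "\<forall>l\<in>{1..m}. 0 < a l"
    \<comment> \<open>\<open>\<pi>\<close> is the direct sum of the irreducible representations with highest weights \<open>\<mu> 1, \<dots>, \<mu> m\<close>\<close>
    and "lie_representation \<gg> \<pi>" "direct_sum_decomposition {1..m} V"
    and "\<forall>l\<in>{1..m}. irreducible_of_highest_weight \<gg> h \<Delta> \<pi> (V l) (\<mu> l)"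
    and "inj \<pi>"
    and "(\<lambda>\<nu>. - w\<^sub>0 \<nu>) ` \<mu> ` {1..m} = \<mu> ` {1..m}"
    and "\<forall>l\<in>{1..m}. \<forall>k\<in>{1..m}. - w\<^sub>0 (\<mu> l) = \<mu> k \<longrightarrow> a l = a k"
  shows "(\<forall>l\<in>P. C\<^sub>Z l \<in> \<real>) \<and>
         (\<exists>L::real. \<forall>l\<in>P. L \<le> Re (C\<^sub>Z l)) \<and>
         filterlim (\<lambda>l. Re (C\<^sub>Z l)) at_top
           (inf (filtercomap (\<lambda>l. Re (dual_form \<gg> h l l)) at_top) (principal P))"
proof -
  interpret lie_algebra \<gg>
    using \<open>lie_representation \<gg> \<pi>\<close> \<open>inj \<pi>\<close> by (rule lie_algebra_of_faithful_representation)
  interpret lie_algebra_with_simple_roots \<gg> h \<Delta>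
    by unfold_locales (fact \<open>cartan_subalgebra \<gg> h\<close>, fact \<open>simple_roots \<gg> h \<Delta>\<close>)
  let ?b = "lie_bracket K c"
  have \<gg>: "\<gg> = complexified_bracket ?b" and simple_b: "simple_lie_algebra ?b" by fact+
  have alg: "lie_algebra (complexified_bracket ?b)" using lie_algebra_axioms unfolding \<gg> .
  obtain X Y where XY: "?b X Y \<noteq> 0" using simple_b unfolding simple_lie_algebra_def by blast
  have "\<gg> (complex_vec X) (complex_vec Y) = complex_vec (?b X Y)"
    unfolding \<gg> by (rule complexified_bracket_complex_vec[OF alg])
  also have "\<dots> \<noteq> 0" using XY by (metis Re_vec_complex_vec complex_vec_0)
  \<comment> \<open>The nonvanishing is proved before the last interpretation, since it is the input
    from which simplicity yields nondegeneracy.\<close>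
  finally obtain x where x: "killing_form \<gg> x x \<noteq> 0" using killing_form_nonzero by blast
  interpret semisimple_lie_algebra \<gg> h \<Delta>
  proof
    show "z = 0" if "\<And>y. killing_form \<gg> z y = 0" for z
      using complexified_simple_nondegenerate[OF alg simple_b x[unfolded \<gg>]] that unfolding \<gg> by blast
  qed
  show ?thesis
    unfolding P_def C\<^sub>Z_def
    by (rule laplacian_eigenvalue_bounded_below_and_proper[where \<mu> = \<mu>]) (use assms in \<open>auto simp only: ball_simps\<close>)
qed

end
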